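(* Let $E\subset\mathbb{R}^2$ be the spiral-type domain given in polar coordinates $(r,\varphi)$ by $$E:= \left\{(r,\varphi):\ \frac{1}{(\varphi + \pi) \, \log^2 (\varphi+\pi)} \le r < \frac 1{\varphi\, \log^2 \varphi}, \ 2\pi \le \varphi < \infty\right\}.$$ Let $p \in [1,\infty)$, $\tau \in [0,1/p]$, and $s\in(0,1/p]$. Then ${\bf 1}_E \in B^{s,\tau}_{p, \infty} (\mathbb{R}^2)$ if and only if $\tau + s \le 1/p$.
   Context: Here $\log=\log_2$, $\log^2 x=(\log x)^2$, and $(r,\varphi)$ stands for the point $(r\cos\varphi,r\sin\varphi)$, with $\varphi$ ranging over $[2\pi,\infty)$ (not reduced modulo $2\pi$). ${\bf 1}_E$ is the characteristic function of $E$. Dyadic cubes: for $j\in\mathbb{Z}$, $k\in\mathbb{Z}^n$ let $Q_{j,k}:=2^{-j}([0,1)^n+k)$ (here $n=2$); $\mathcal{Q}$ is the set of all of them; $\ell(P)$ is the edge length of $P$ and $j_P:=-\log_2\ell(P)$. Function spaces: fix $\varphi_0,\varphi\in\mathcal{S}(\mathbb{R}^n)$ with real-valued nonnegative Fourier transforms such that $\mathrm{supp}\,\mathcal{F}\varphi_0\subset\{|\xi|\le 2\}$, $|\mathcal{F}\varphi_0(\xi)|\ge C>0$ for $|\xi|\le 5/3$, $\mathrm{supp}\,\mathcal{F}\varphi\subset\{1/2\le|\xi|\le 2\}$, $|\mathcal{F}\varphi(\xi)|\ge C>0$ for $3/5\le|\xi|\le 5/3$; put $\varphi_j:=2^{jn}\varphi(2^j\cdot)$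 for $j\ge 1$. For $s\in\mathbb{R}$, $\tau\in[0,\infty)$, $p,q\in(0,\infty]$, the Besov-type space $B^{s,\tau}_{p,q}(\mathbb{R}^n)$ is the set of all $f\in\mathcal{S}'(\mathbb{R}^n)$ with $$\|f\|_{B^{s,\tau}_{p,q}(\mathbb{R}^n)}:=\sup_{P\in\mathcal{Q}}\frac1{|P|^{\tau}}\Big\{\sum_{j=\max\{j_P,0\}}^\infty 2^{js q}\Big[\int_P|\varphi_j\ast f(x)|^p\,dx\Big]^{q/p}\Big\}^{1/q}<\infty,$$ with the usual modifications if $p=\infty$ and/or $q=\infty$. *)

theory Defs
  imports "HOL-Probability.Probability"
begin

section \<open>Schwartz functions and tempered distributions on \<open>\<real>\<^sup>n\<close>\<close>

definition partial_deriv :: "'n::finite \<Rightarrow> (real^'n \<Rightarrow> complex) \<Rightarrow> real^'n \<Rightarrow> complex" where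
  "partial_deriv i f x = vector_derivative (\<lambda>t. f (x + t *\<^sub>R axis i 1)) (at 0)"

text \<open>Iterated partial derivatives are indexed by lists of coordinate directions
  instead of multi-indices.\<close>

definition partial_derivs :: "'n::finite list \<Rightarrow> (real^'n \<Rightarrow> complex) \<Rightarrow> real^'n \<Rightarrow> complex" where
  "partial_derivs is f = foldr partial_deriv is f"

definition schwartz :: "(real^'n::finite \<Rightarrow> complex) set" where
  "schwartz = {f. \<forall>is. partial_derivs is f differentiable_on UNIV \<and>
      (\<forall>N::nat. bounded (range (\<lambda>x. (1 + norm x) ^ N *\<^sub>R partial_derivs is f x)))}"

definition schwartz_seminorm :: "nat \<Rightarrow> 'n::finite list \<Rightarrow> (real^'n \<Rightarrow> complex) \<Rightarrow> real" where
  "schwartz_seminorm N is f = (SUP x. (1 + norm x) ^ N * norm (partial_derivs is f x))"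

text \<open>A tempered distribution is a linear functional on the Schwartz space that is bounded by
  finitely many of the seminorms. As a HOL function it is \<open>undefined\<close> outside the Schwartz
  space, so that equality of functions is equality of distributions.\<close>

definition tempered_distributions :: "((real^'n::finite \<Rightarrow> complex) \<Rightarrow> complex) set" where
  "tempered_distributions = {T \<in> extensional schwartz.
      (\<forall>f\<in>schwartz. \<forall>g\<in>schwartz. T (\<lambda>x. f x + g x) = T f + T g) \<and>
      (\<forall>c. \<forall>f\<in>schwartz. T (\<lambda>x. c * f x) = c * T f) \<and>
      (\<exists>C N. \<forall>f\<in>schwartz.
         norm (T f) \<le> C * (\<Sum>is \<in> {is. length is \<le> N}. schwartz_seminorm N is f))}"

text \<open>The distribution identified with a (locally integrable) function.\<close>

definition regular_distribution ::
  "(real^'n::finite \<Rightarrow> complex) \<Rightarrow> (real^'n \<Rightarrow> complex) \<Rightarrow> complex" where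
  "regular_distribution g = (\<lambda>\<psi>\<in>schwartz. \<integral>x. g x * \<psi> x \<partial>lebesgue)"

definition conv_distribution ::
  "(real^'n::finite \<Rightarrow> complex) \<Rightarrow> ((real^'n \<Rightarrow> complex) \<Rightarrow> complex) \<Rightarrow> real^'n \<Rightarrow> complex" where
  "conv_distribution \<psi> T x = T (\<lambda>y. \<psi> (x - y))"

definition fourier :: "(real^'n::finite \<Rightarrow> complex) \<Rightarrow> real^'n \<Rightarrow> complex" where
  "fourier f \<xi> = of_real ((2 * pi) powr (- real CARD('n) / 2)) *
     (\<integral>x. f x * exp (- \<i> * of_real (x \<bullet> \<xi>)) \<partial>lebesgue)"


section \<open>Besov-type spaces\<close>

definition dyadic_cube :: "int \<Rightarrow> int^'n::finite \<Rightarrow> (real^'n) set" where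
  "dyadic_cube j k = {x. \<forall>i. 2 powi (- j) * of_int (k $ i) \<le> x $ i \<and>
                           x $ i < 2 powi (- j) * (of_int (k $ i) + 1)}"

definition admissible_pair ::
  "(real^'n::finite \<Rightarrow> complex) \<Rightarrow> (real^'n \<Rightarrow> complex) \<Rightarrow> bool" where
  "admissible_pair \<phi>0 \<phi> \<longleftrightarrow>
     \<phi>0 \<in> schwartz \<and> \<phi> \<in> schwartz \<and>
     (\<forall>\<xi>. fourier \<phi>0 \<xi> \<in> \<real>\<^sub>\<ge>\<^sub>0 \<and> fourier \<phi> \<xi> \<in> \<real>\<^sub>\<ge>\<^sub>0) \<and>
     closure {\<xi>. fourier \<phi>0 \<xi> \<noteq> 0} \<subseteq> {\<xi>. norm \<xi> \<le> 2} \<and>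
     (\<exists>C>0. \<forall>\<xi>. norm \<xi> \<le> 5/3 \<longrightarrow> C \<le> norm (fourier \<phi>0 \<xi>)) \<and>
     closure {\<xi>. fourier \<phi> \<xi> \<noteq> 0} \<subseteq> {\<xi>. 1/2 \<le> norm \<xi> \<and> norm \<xi> \<le> 2} \<and>
     (\<exists>C>0. \<forall>\<xi>. 3/5 \<le> norm \<xi> \<and> norm \<xi> \<le> 5/3 \<longrightarrow> C \<le> norm (fourier \<phi> \<xi>))"

definition dilated_family ::
  "(real^'n::finite \<Rightarrow> complex) \<Rightarrow> (real^'n \<Rightarrow> complex) \<Rightarrow> nat \<Rightarrow> real^'n \<Rightarrow> complex" where
  "dilated_family \<phi>0 \<phi> j =
     (if j = 0 then \<phi>0 else (\<lambda>x. 2 ^ (j * CARD('n)) * \<phi> (2 ^ j *\<^sub>R x)))"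

text \<open>Powers of extended nonnegative reals, for exponents \<open>a > 0\<close> only.\<close>

definition ennpowr :: "ennreal \<Rightarrow> real \<Rightarrow> ennreal" where
  "ennpowr x a = (if x = \<infinity> then \<infinity> else ennreal (enn2real x powr a))"

definition Lp_quasinorm :: "ennreal \<Rightarrow> (real^'n::finite) set \<Rightarrow> (real^'n \<Rightarrow> complex) \<Rightarrow> ennreal" where
  "Lp_quasinorm p P g =
     (if p = \<infinity> then esssup (restrict_space lebesgue P) (\<lambda>x. ennreal (norm (g x)))
      else ennpowr (\<integral>\<^sup>+x\<in>P. ennreal (norm (g x) powr enn2real p) \<partial>lebesgue) (1 / enn2real p))"

definition lq_quasinorm :: "ennreal \<Rightarrow> nat set \<Rightarrow> (nat \<Rightarrow> ennreal) \<Rightarrow> ennreal" where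
  "lq_quasinorm q J a =
     (if q = \<infinity> then (SUP j\<in>J. a j)
      else ennpowr (\<Sum>\<^sub>\<infinity>j\<in>J. ennpowr (a j) (enn2real q)) (1 / enn2real q))"

text \<open>The supremum over all dyadic cubes \<open>P\<close> is written as a supremum over \<open>(m, k)\<close> with
  \<open>P = Q\<^bsub>m,k\<^esub>\<close>, so that \<open>j\<^sub>P = m\<close>; then \<open>nat m = max {j\<^sub>P, 0}\<close>.\<close>

definition besov_type_norm ::
  "(real^'n::finite \<Rightarrow> complex) \<Rightarrow> (real^'n \<Rightarrow> complex) \<Rightarrow> real \<Rightarrow> real \<Rightarrow> ennreal \<Rightarrow> ennreal
    \<Rightarrow> ((real^'n \<Rightarrow> complex) \<Rightarrow> complex) \<Rightarrow> ennreal" where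
  "besov_type_norm \<phi>0 \<phi> s \<tau> p q T =
     (SUP m :: int. SUP k :: int^'n.
        ennreal (1 / measure lebesgue (dyadic_cube m k) powr \<tau>) *
        lq_quasinorm q {nat m..}
          (\<lambda>j. ennreal (2 powr (real j * s)) *
            Lp_quasinorm p (dyadic_cube m k) (conv_distribution (dilated_family \<phi>0 \<phi> j) T)))"

definition besov_type_space ::
  "(real^'n::finite \<Rightarrow> complex) \<Rightarrow> (real^'n \<Rightarrow> complex) \<Rightarrow> real \<Rightarrow> real \<Rightarrow> ennreal \<Rightarrow> ennreal
    \<Rightarrow> ((real^'n \<Rightarrow> complex) \<Rightarrow> complex) set" where
  "besov_type_space \<phi>0 \<phi> s \<tau> p q =
     {T \<in> tempered_distributions. besov_type_norm \<phi>0 \<phi> s \<tau> p q T < \<infinity>}"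


section \<open>The spiral-type domain\<close>

definition spiral :: "(real^2) set" where
  "spiral = {vector [r * cos t, r * sin t] | r t.
     2 * pi \<le> t \<and>
     1 / ((t + pi) * (log 2 (t + pi))\<^sup>2) \<le> r \<and> r < 1 / (t * (log 2 t)\<^sup>2)}"

end

theory Submission
  imports Defs "HOL-Real_Asymp.Real_Asymp"
begin

text \<open>Write \<open>E\<close> for the spiral, \<open>g t = 1 / (t (log t)\<^sup>2)\<close> for the radius of its outer edge and \<open>f\<^sub>j\<close> for the
convolution of its indicator with the \<open>j\<close>-th function of the family. After a change of variables,
\<open>f\<^sub>j x = \<integral> \<phi> w 1\<^sub>E (x - \<delta> w) dw\<close> with \<open>\<delta> = 2\<^sup>-\<^sup>j\<close>, so that one looks at \<open>E\<close> through a
window of width \<open>\<delta>\<close>.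

If \<open>\<tau> + s \<le> 1 / p\<close>: two crude bounds suffice. The functions \<open>f\<^sub>j\<close> are uniformly bounded, hence the
integral of \<open>|f\<^sub>j|\<^sup>p\<close> over a cube \<open>P\<close> is at most a multiple of \<open>|P|\<close>. Moreover \<open>E\<close> has finite perimeter,
because \<open>1 / (t (log t)\<^sup>2)\<close> is integrable at infinity; as \<open>\<phi>\<close> has mean zero, the \<open>L\<^sup>1\<close> norm of \<open>f\<^sub>j\<close> is at
most a multiple of \<open>2\<^sup>-\<^sup>j\<close> (lemma \<open>spiral_conv_L1_cancellation\<close>). Thus the integral of \<open>|f\<^sub>j|\<^sup>p\<close> over a
cube of edge length \<open>2\<^sup>-\<^sup>m\<close> is at most a multiple of the smaller of \<open>2\<^sup>-\<^sup>2\<^sup>m\<close> and \<open>2\<^sup>-\<^sup>j\<close>, and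
an elementary inequality for the exponents bounds the norm.

If \<open>\<tau> + s > 1 / p\<close>: take the cube \<open>P\<close> of edge length \<open>l = 2\<^sup>-\<^sup>m\<close> with a corner at the origin and look at the
single scale \<open>j = 2 m\<close>, that is, \<open>\<delta> = l\<^sup>2\<close>. At distance about \<open>l\<close> from the origin consecutive turns
of the spiral are about \<open>l\<^sup>2 m\<^sup>2\<close> apart. This is much larger than \<open>\<delta>\<close>, so that near a point of the outer edge
the window only sees a half-plane (lemma \<open>spiral_blowup\<close>). The integrals of \<open>\<phi>\<close> over the half-planes with a
fixed normal cannot all vanish, because the Fourier transform of \<open>\<phi>\<close> does not vanish on the unit circle; hence
\<open>|f\<^sub>j|\<close> is bounded below on a disc of radius comparable to \<open>\<delta>\<close> near every point of the outer edge that is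
close to the origin and seen from there almost in the direction of the first axis
(lemma \<open>spiral_conv_lower_bound\<close>). On the other hand \<open>l\<^sup>2 m\<^sup>2\<close> exceeds \<open>\<delta>\<close> only by a factor
\<open>m\<^sup>2\<close>, and every point of \<open>P\<close> in a suitable sector, at distance about \<open>l\<close> from the origin, has such a
point of the edge within this distance. By averaging, \<open>|f\<^sub>j|\<close> is bounded below on a part of \<open>P\<close> of area at least a multiple of
\<open>l\<^sup>2 / m\<^sup>4\<close> (lemma \<open>spiral_conv_large_set\<close>). The norm is therefore at least a multiple of
\<open>2\<^sup>2\<^sup>m\<^sup>(\<^sup>\<tau>\<^sup>+\<^sup>s\<^sup>-\<^sup>1\<^sup>/\<^sup>p\<^sup>)\<close> divided by a power of \<open>m\<close>, and this is unbounded.\<close>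

section \<open>The spiral in polar coordinates\<close>

text \<open>The radius of the outer edge at the angle \<open>t\<close>, which is not reduced modulo \<open>2 \<pi>\<close>. The inner edge is the same
curve half a turn later.\<close>

definition spiral_radius :: "real \<Rightarrow> real" where
  "spiral_radius t = 1 / (t * (log 2 t)\<^sup>2)"

definition polar :: "real \<Rightarrow> real \<Rightarrow> real^2" where
  "polar r t = vector [r * cos t, r * sin t]"

text \<open>The choice of the argument in \<open>[0, 2 \<pi>)\<close> puts the cut on the positive half-axis, where the spiral starts;
hence the turns of the spiral are numbered consistently over the whole slit plane.\<close>

definition angle :: "real^2 \<Rightarrow> real" where
  "angle x = Arg2pi (Complex (x $ 1) (x $ 2))"

lemma polar_nth [simp]: "polar r t $ 1 = r * cos t" "polar r t $ 2 = r * sin t"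
  by (simp_all add: polar_def)

lemma vec2_eqI: "x $ 1 = y $ 1 \<Longrightarrow> x $ 2 = y $ 2 \<Longrightarrow> x = y" for x y :: "real^2"
  by (simp add: vec_eq_iff forall_2)

lemma norm_vec2: "norm x = sqrt ((x $ 1)\<^sup>2 + (x $ 2)\<^sup>2)" for x :: "real^2"
  by (simp add: norm_vec_def L2_set_def sum_2)

lemma norm_vec2_le: "norm x \<le> \<bar>x $ 1\<bar> + \<bar>x $ 2\<bar>" for x :: "real^2"
  using norm_le_l1_cart[of x] by (simp add: sum_2)

lemma norm_polar [simp]: "norm (polar r t) = \<bar>r\<bar>"
proof -
  have "(r * cos t)\<^sup>2 + (r * sin t)\<^sup>2 = r\<^sup>2"
    using sin_cos_squared_add[of t] by (simp add: power_mult_distrib add.commute flip: distrib_left)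
  then show ?thesis by (simp add: norm_vec2)
qed

lemma spiral_radius_pos: "1 < t \<Longrightarrow> 0 < spiral_radius t"
proof -
  assume "1 < t"
  then have "0 < (log 2 t)\<^sup>2" by (intro zero_less_power) simp
  with \<open>1 < t\<close> show ?thesis unfolding spiral_radius_def by (intro divide_pos_pos mult_pos_pos) auto
qed

lemma spiral_radius_strict_antimono:
  assumes "1 < t" "t < u" shows "spiral_radius u < spiral_radius t"
proof -
  have l: "0 < log 2 t" "log 2 t < log 2 u" using assms by auto
  then have "(log 2 t)\<^sup>2 < (log 2 u)\<^sup>2" by (intro power_strict_mono) auto
  then have "t * (log 2 t)\<^sup>2 < u * (log 2 u)\<^sup>2"
    using assms l by (intro mult_strict_mono) auto
  moreover have "0 < t * (log 2 t)\<^sup>2" using assms l(1) by (intro mult_pos_pos zero_less_power) auto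
  ultimately show ?thesis unfolding spiral_radius_def by (intro divide_strict_left_mono) auto
qed

lemma spiral_radius_antimono:
  "1 < t \<Longrightarrow> t \<le> u \<Longrightarrow> spiral_radius u \<le> spiral_radius t"
  using spiral_radius_strict_antimono[of t u] by (cases "t = u") auto

lemma spiral_radius_less_imp_less:
  "1 < t \<Longrightarrow> 1 < u \<Longrightarrow> spiral_radius u < spiral_radius t \<Longrightarrow> t < u"
  using spiral_radius_antimono[of u t] by linarith

lemma spiral_radius_tendsto_0: "(spiral_radius \<longlongrightarrow> 0) at_top"
  unfolding spiral_radius_def by real_asymp

lemma continuous_spiral_radius:
  "1 < t \<Longrightarrow> isCont spiral_radius t"
  unfolding spiral_radius_def [abs_def]
  by (intro continuous_intros) (auto simp: log_def)

lemma spiral_radius_le_half: "2 \<le> t \<Longrightarrow> spiral_radius t \<le> 1/2"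
  using spiral_radius_antimono[of 2 t] by (simp add: spiral_radius_def)

lemma pi_bounds: "3 < pi" "pi < 4"
  using pi_approx by (simp_all add: field_simps)

text \<open>Two pairs of polar coordinates with positive radii give the same point only if the radii agree and the angles
differ by a multiple of the full turn.\<close>

lemma polar_in_spiral_iff:
  assumes r: "0 < r"
  shows "polar r \<alpha> \<in> spiral \<longleftrightarrow>
    (\<exists>k::int. 2 * pi \<le> \<alpha> + 2 * pi * k \<and> spiral_radius (\<alpha> + 2 * pi * k + pi) \<le> r \<and>
       r < spiral_radius (\<alpha> + 2 * pi * k))"
proof
  assume "polar r \<alpha> \<in> spiral"
  then obtain r' t where eq: "polar r \<alpha> = polar r' t" and t: "2 * pi \<le> t"
    "spiral_radius (t + pi) \<le> r'" "r' < spiral_radius t"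
    unfolding spiral_def spiral_radius_def polar_def by auto
  have "0 < spiral_radius (t + pi)" using t pi_bounds by (intro spiral_radius_pos) auto
  then have "r' > 0" using t by linarith
  moreover have "\<bar>r\<bar> = \<bar>r'\<bar>" using eq norm_polar by metis
  ultimately have rr: "r' = r" using r by auto
  have "polar r \<alpha> $ 1 = polar r t $ 1" "polar r \<alpha> $ 2 = polar r t $ 2" using eq rr by simp_all
  then have "sin t = sin \<alpha> \<and> cos t = cos \<alpha>" using r by simp
  then obtain k::int where "t = \<alpha> + 2 * pi * k" unfolding sin_cos_eq_iff by auto
  with t rr show "\<exists>k::int. 2 * pi \<le> \<alpha> + 2 * pi * k \<and> spiral_radius (\<alpha> + 2 * pi * k + pi) \<le> r \<and>
       r < spiral_radius (\<alpha> + 2 * pi * k)" by auto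
next
  assume "\<exists>k::int. 2 * pi \<le> \<alpha> + 2 * pi * k \<and> spiral_radius (\<alpha> + 2 * pi * k + pi) \<le> r \<and>
       r < spiral_radius (\<alpha> + 2 * pi * k)"
  then obtain k::int where k: "2 * pi \<le> \<alpha> + 2 * pi * k" "spiral_radius (\<alpha> + 2 * pi * k + pi) \<le> r"
     "r < spiral_radius (\<alpha> + 2 * pi * k)" by blast
  have "sin (\<alpha> + 2 * pi * k) = sin \<alpha> \<and> cos (\<alpha> + 2 * pi * k) = cos \<alpha>"
    unfolding sin_cos_eq_iff by blast
  then have "polar r \<alpha> = vector [r * cos (\<alpha> + 2 * pi * k), r * sin (\<alpha> + 2 * pi * k)]"
    by (simp add: polar_def)
  then show "polar r \<alpha> \<in> spiral"
    unfolding spiral_def using k unfolding spiral_radius_def by blast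
qed

lemma angle_bounds: "0 \<le> angle x" "angle x < 2 * pi"
  using Arg2pi by (auto simp: angle_def)

lemma polar_angle: "polar (norm x) (angle x) = x"
proof -
  let ?z = "Complex (x $ 1) (x $ 2)"
  have n: "cmod ?z = norm x" by (simp add: norm_vec2 cmod_def)
  have "?z = of_real (norm x) * exp (\<i> * of_real (angle x))"
    using Arg2pi_eq[of ?z] n by (simp add: angle_def)
  then have "Re ?z = norm x * cos (angle x)" "Im ?z = norm x * sin (angle x)"
    by (simp_all add: Re_exp Im_exp)
  then show ?thesis by (intro vec2_eqI) auto
qed

definition pos_axis :: "(real^2) set" where
  "pos_axis = {x. 0 \<le> x $ 1 \<and> x $ 2 = 0}"

lemma Complex_in_nonneg_Reals_iff:
  "Complex (x $ 1) (x $ 2) \<in> \<real>\<^sub>\<ge>\<^sub>0 \<longleftrightarrow> x \<in> pos_axis" for x :: "real^2"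
  by (auto simp: pos_axis_def complex_nonneg_Reals_iff)

lemma continuous_angle: "x \<notin> pos_axis \<Longrightarrow> isCont angle x"
proof -
  assume x: "x \<notin> pos_axis"
  have "isCont (Arg2pi \<circ> (\<lambda>x::real^2. Complex (x $ 1) (x $ 2))) x"
    unfolding Complex_eq
    by (intro continuous_at_compose continuous_intros continuous_at_Arg2pi)
       (use x Complex_in_nonneg_Reals_iff in \<open>simp add: flip: Complex_eq\<close>)
  then show ?thesis by (simp add: o_def angle_def [abs_def])
qed

lemma closed_pos_axis: "closed pos_axis"
  unfolding pos_axis_def by (intro closed_Collect_conj closed_Collect_le closed_Collect_eq continuous_intros)

lemma angle_pos_axis: "x \<in> pos_axis \<Longrightarrow> angle x = 0"
  by (auto simp: angle_def Arg2pi_eq_0 pos_axis_def complex_is_Real_iff)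

text \<open>The angle is continuous off the cut and constant on the cut.\<close>

lemma borel_measurable_angle [measurable]: "angle \<in> borel_measurable borel"
proof -
  have "(\<lambda>x. if x \<in> pos_axis then 0 else angle x) \<in> borel_measurable borel"
    by (intro borel_measurable_continuous_on_if continuous_at_imp_continuous_on ballI)
       (auto simp: closed_pos_axis intro!: borel_closed continuous_angle)
  also have "(\<lambda>x. if x \<in> pos_axis then 0 else angle x) = angle"
    using angle_pos_axis by auto
  finally show ?thesis .
qed

lemma zero_notin_spiral: "0 \<notin> spiral"
proof
  assume "0 \<in> spiral"
  then obtain r t where "0 = polar r t" and t: "2 * pi \<le> t" "spiral_radius (t + pi) \<le> r"
    unfolding spiral_def spiral_radius_def polar_def by auto
  then have "norm (polar r t) = 0" by (metis norm_zero)
  then have "r = 0" by simp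
  moreover have "0 < spiral_radius (t + pi)" using t pi_bounds by (intro spiral_radius_pos) auto
  ultimately show False using t by linarith
qed

lemma spiral_iff_angle:
  "x \<in> spiral \<longleftrightarrow> x \<noteq> 0 \<and>
    (\<exists>k::nat. spiral_radius (angle x + 2 * pi * (real k + 1) + pi) \<le> norm x \<and>
       norm x < spiral_radius (angle x + 2 * pi * (real k + 1)))"
proof (cases "x = 0")
  case True then show ?thesis using zero_notin_spiral by auto
next
  case False
  have "x \<in> spiral \<longleftrightarrow> polar (norm x) (angle x) \<in> spiral" by (simp add: polar_angle)
  also have "\<dots> \<longleftrightarrow> (\<exists>k::int. 2 * pi \<le> angle x + 2 * pi * k \<and>
      spiral_radius (angle x + 2 * pi * k + pi) \<le> norm x \<and> norm x < spiral_radius (angle x + 2 * pi * k))"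
    using False by (intro polar_in_spiral_iff) auto
  also have "\<dots> \<longleftrightarrow> (\<exists>k::nat. spiral_radius (angle x + 2 * pi * (real k + 1) + pi) \<le> norm x \<and>
       norm x < spiral_radius (angle x + 2 * pi * (real k + 1)))" (is "?L \<longleftrightarrow> ?R")
  proof
    assume ?L
    then obtain k::int where k: "2 * pi \<le> angle x + 2 * pi * k"
      "spiral_radius (angle x + 2 * pi * k + pi) \<le> norm x" "norm x < spiral_radius (angle x + 2 * pi * k)"
      by blast
    have "2 * pi * 0 < 2 * pi * real_of_int k" using k(1) angle_bounds(2)[of x] by simp
    then have "0 < real_of_int k" using pi_gt_zero mult_less_cancel_left_pos[of "2*pi" 0 "real_of_int k"] by simp
    then have "real_of_int k = real (nat (k - 1)) + 1" by linarith
    with k show ?R by metis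
  next
    assume ?R
    then obtain k::nat where k: "spiral_radius (angle x + 2 * pi * (real k + 1) + pi) \<le> norm x"
       "norm x < spiral_radius (angle x + 2 * pi * (real k + 1))" by blast
    have "2 * pi \<le> angle x + 2 * pi * of_int (int k + 1)"
      using angle_bounds(1)[of x] by (simp add: algebra_simps)
    then show ?L using k by (intro exI[of _ "int k + 1"]) auto
  qed
  finally show ?thesis using False by simp
qed

lemma borel_measurable_spiral_radius [measurable]: "spiral_radius \<in> borel_measurable borel"
  unfolding spiral_radius_def [abs_def] log_def by measurable

lemma sets_spiral [measurable]: "spiral \<in> sets borel"
proof -
  have "spiral = {x. x \<noteq> 0 \<and> (\<exists>k::nat. spiral_radius (angle x + 2 * pi * (real k + 1) + pi) \<le> norm x \<and>
       norm x < spiral_radius (angle x + 2 * pi * (real k + 1)))}"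
    using spiral_iff_angle by blast
  also have "\<dots> \<in> sets borel" by measurable
  finally show ?thesis .
qed

lemma spiral_subset_cball: "spiral \<subseteq> cball 0 (1/2)"
proof
  fix x assume "x \<in> spiral"
  then obtain k::nat where k: "norm x < spiral_radius (angle x + 2 * pi * (real k + 1))"
    unfolding spiral_iff_angle by blast
  have "2 * 3 * 1 \<le> 2 * pi * (real k + 1)" using pi_bounds by (intro mult_mono) auto
  then have "spiral_radius (angle x + 2 * pi * (real k + 1)) \<le> 1/2"
    using angle_bounds(1)[of x] by (intro spiral_radius_le_half) simp
  then show "x \<in> cball 0 (1/2)" using k by simp
qed

text \<open>As \<open>g\<close> decreases to 0, any value below \<open>g t\<close> is passed between two consecutive members of the arithmetic
progression of angles that starts at \<open>t\<close>. With step \<open>\<pi>\<close> this decides whether a point lies in the spiral; with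
step \<open>2 \<pi>\<close> it yields the nearest outer edge along a ray.\<close>

lemma spiral_radius_bracket:
  fixes t d r :: real
  assumes "1 < t" "0 < d" "0 < r" "r < spiral_radius t"
  obtains n :: nat where "spiral_radius (t + d * (real n + 1)) \<le> r" "r < spiral_radius (t + d * real n)"
proof -
  have "filterlim (\<lambda>n. t + d * real n) at_top sequentially"
    using assms(2) by real_asymp
  from order_tendstoD(2)[OF filterlim_compose[OF spiral_radius_tendsto_0 this] \<open>0 < r\<close>]
  obtain n where n: "spiral_radius (t + d * real n) < r" by (auto simp: eventually_sequentially)
  define m where "m = (LEAST n. spiral_radius (t + d * real n) \<le> r)"
  have m: "spiral_radius (t + d * real m) \<le> r"
    unfolding m_def by (rule LeastI[of _ n]) (use n in simp)
  have "m \<noteq> 0" using m assms(4) by (metis mult_zero_right add_0_right not_le of_nat_0)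
  then obtain l where l: "m = Suc l" using not0_implies_Suc by blast
  have "\<not> spiral_radius (t + d * real l) \<le> r"
    using not_less_Least[of l "\<lambda>n. spiral_radius (t + d * real n) \<le> r"] l unfolding m_def by simp
  then show ?thesis using that[of l] m l by (simp add: algebra_simps)
qed

section \<open>The boundary of the spiral has finite length\<close>

text \<open>About \<open>1 / h\<close> points on the curve, at parameter distance \<open>h\<close>, come within \<open>(L + 1) h\<close> of every point of
the neighbourhood, and the discs of this radius around them have total area of order \<open>h\<close>. The curve is assumed to be
Lipschitz beyond the parameter 1 so that the last of these points may overshoot.\<close>

lemma emeasure_neighbourhood_Lipschitz_curve:
  fixes F :: "real \<Rightarrow> real^2"
  assumes L: "0 \<le> L" and F: "\<And>u v. 0 < u \<Longrightarrow> u \<le> v \<Longrightarrow> v \<le> 2 \<Longrightarrow> dist (F u) (F v) \<le> L * (v - u)"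
    and h: "0 < h" "h \<le> 1"
    and A: "\<And>x. x \<in> A \<Longrightarrow> \<exists>u. 0 < u \<and> u \<le> 1 \<and> dist x (F u) \<le> h"
  obtains B where "B \<in> sets borel" "A \<subseteq> B" "emeasure lborel B \<le> ennreal (8 * (L + 1)\<^sup>2 * h)"
proof -
  define N where "N = nat \<lceil>1 / h\<rceil>"
  have h1: "1 \<le> 1 / h" using h by (simp add: field_simps)
  have N: "1 / h \<le> real N" "real N \<le> 2 / h"
  proof -
    show "1 / h \<le> real N" unfolding N_def by linarith
    have "real N < 1 / h + 1" unfolding N_def using h1 by linarith
    then show "real N \<le> 2 / h" using h1 by simp
  qed
  define B where "B i = cball (F (real i * h)) ((L + 1) * h)" for i
  have sub: "A \<subseteq> (\<Union>i\<in>{1..N}. B i)"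
  proof
    fix x assume "x \<in> A"
    then obtain u where u: "0 < u" "u \<le> 1" "dist x (F u) \<le> h" using A by blast
    define i where "i = nat \<lceil>u / h\<rceil>"
    have uh: "0 < u / h" using u h by simp
    have i: "u / h \<le> real i" "real i < u / h + 1" unfolding i_def using uh by linarith+
    have "i \<ge> 1" using i(1) uh by (cases i) auto
    have "u / h \<le> 1 / h" using u h by (simp add: divide_right_mono)
    then have "i \<le> N" unfolding i_def N_def by (intro nat_mono ceiling_mono)
    have a: "u \<le> real i * h" "real i * h < u + h" using i h by (simp_all add: field_simps)
    have "dist (F u) (F (real i * h)) \<le> L * (real i * h - u)"
      by (rule F) (use u a h in linarith)+
    also have "\<dots> \<le> L * h" using a L by (intro mult_left_mono) auto
    finally have "dist x (F (real i * h)) \<le> (L + 1) * h"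
      using u(3) dist_triangle[of x "F (real i * h)" "F u"] by (simp add: algebra_simps)
    then have "x \<in> B i" by (simp add: B_def dist_commute)
    then show "x \<in> (\<Union>i\<in>{1..N}. B i)" using \<open>i \<ge> 1\<close> \<open>i \<le> N\<close> by auto
  qed
  have "emeasure lborel (\<Union>i\<in>{1..N}. B i) \<le> (\<Sum>i\<in>{1..N}. emeasure lborel (B i))"
    by (intro emeasure_subadditive_finite) (auto simp: B_def)
  also have "\<dots> = (\<Sum>i\<in>{1..N}. ennreal (pi * ((L + 1) * h)\<^sup>2))"
    using h L by (intro sum.cong) (auto simp: B_def emeasure_cball unit_ball_vol_2)
  also have "\<dots> = ennreal (real N * (pi * ((L + 1) * h)\<^sup>2))"
    by (subst sum_ennreal) auto
  also have "\<dots> \<le> ennreal (8 * (L + 1)\<^sup>2 * h)"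
  proof (rule ennreal_leI)
    have "real N * (pi * ((L + 1) * h)\<^sup>2) \<le> (2 / h) * (4 * ((L + 1) * h)\<^sup>2)"
      using N pi_bounds h by (intro mult_mono) auto
    also have "\<dots> = 8 * (L + 1)\<^sup>2 * h" using h by (simp add: field_simps power2_eq_square)
    finally show "real N * (pi * ((L + 1) * h)\<^sup>2) \<le> 8 * (L + 1)\<^sup>2 * h" .
  qed
  finally show ?thesis using sub by (intro that[of "\<Union>i\<in>{1..N}. B i"]) (auto simp: B_def)
qed

text \<open>The edge of the spiral with the parameter \<open>u = 1 / ln t\<close>. Its speed with respect to \<open>t\<close> is about
\<open>1 / (t (ln t)\<^sup>2)\<close>, which is the derivative of \<open>- 1 / ln t\<close>; so the whole infinite spiral becomes a Lipschitz curve
on a bounded interval.\<close>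

definition spiral_arm :: "real \<Rightarrow> real^2" where
  "spiral_arm u = polar (spiral_radius (exp (1 / u))) (exp (1 / u))"

lemma spiral_radius_exp:
  assumes "0 < u" shows "spiral_radius (exp (1 / u)) = (ln 2)\<^sup>2 * (u\<^sup>2 * exp (- 1 / u))"
  using assms by (simp add: spiral_radius_def log_def field_simps exp_minus)

text \<open>In the parameter \<open>u\<close> the curve is \<open>(ln 2)\<^sup>2 u\<^sup>2 exp (- 1 / u)\<close> times the unit vector with angle
\<open>exp (1 / u)\<close>. The rapidly growing derivative of the angle is cancelled exactly by the factor in front.\<close>

lemma spiral_arm_Lipschitz:
  assumes "0 < u" "u \<le> v" "v \<le> 2"
  shows "dist (spiral_arm u) (spiral_arm v) \<le> 12 * (v - u)"
proof -
  define c where "c = (ln (2::real))\<^sup>2"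
  have "ln (2::real) \<le> 1" using ln_2_less_1 by simp
  then have c: "0 \<le> c" "c \<le> 1" unfolding c_def by (auto intro: power_le_one)
  \<comment> \<open>Both coordinates have a derivative of this form, with sine and cosine as \<open>C\<close> and \<open>D\<close> up to sign.\<close>
  have key: "\<bar>f u - f v\<bar> \<le> 6 * (v - u)"
    if d: "\<And>x. 0 < x \<Longrightarrow> (f has_real_derivative (2 * x * exp (- 1 / x) + exp (- 1 / x)) * c * C x + c * D x) (at x)"
      and b: "\<And>x. \<bar>C x\<bar> \<le> 1" "\<And>x. \<bar>D x\<bar> \<le> 1"
    for f C D :: "real \<Rightarrow> real"
  proof (cases "u = v")
    case True then show ?thesis by simp
  next
    case False
    then have "u < v" using assms by simp
    from MVT2[OF this, of f "\<lambda>x. (2 * x * exp (- 1 / x) + exp (- 1 / x)) * c * C x + c * D x"]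
    obtain z where z: "u < z" "z < v" and eq: "f v - f u = (v - u) * ((2 * z * exp (- 1 / z) + exp (- 1 / z)) * c * C z + c * D z)"
      using d assms by force
    have e: "exp (- 1 / z) \<le> 1" using z assms by simp
    have "\<bar>(2 * z * exp (- 1 / z) + exp (- 1 / z)) * c * C z + c * D z\<bar>
        \<le> \<bar>2 * z * exp (- 1 / z) + exp (- 1 / z)\<bar> * \<bar>c\<bar> * \<bar>C z\<bar> + \<bar>c\<bar> * \<bar>D z\<bar>"
      by (simp flip: abs_mult)
    also have "\<dots> \<le> (2 * 2 * 1 + 1) * 1 * 1 + 1 * 1"
    proof (intro add_mono mult_mono)
      show "\<bar>2 * z * exp (- 1 / z) + exp (- 1 / z)\<bar> \<le> 2 * 2 * 1 + 1"
      proof -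
        have "z * exp (- 1 / z) \<le> 2 * 1" "0 \<le> z * exp (- 1 / z)" using z assms e by (intro mult_mono mult_nonneg_nonneg; simp)+
        moreover have "0 \<le> exp (- 1 / z)" by simp
        ultimately show ?thesis using e unfolding mult.assoc by linarith
      qed
    qed (use c b in auto)
    finally have "\<bar>f v - f u\<bar> \<le> (v - u) * 6"
      unfolding eq abs_mult using \<open>u < v\<close> by (intro mult_mono) auto
    then show ?thesis by (simp add: abs_minus_commute mult.commute)
  qed
  have ee: "exp (1 / x) * exp (- 1 / x) = 1" for x :: real by (simp flip: exp_add)
  have n: "spiral_arm x $ 1 = c * (x\<^sup>2 * exp (- 1 / x)) * cos (exp (1 / x))"
       "spiral_arm x $ 2 = c * (x\<^sup>2 * exp (- 1 / x)) * sin (exp (1 / x))" if "0 < x" for x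
    using that by (simp_all add: spiral_arm_def spiral_radius_exp c_def)
  have 1: "\<bar>c * (u\<^sup>2 * exp (- 1 / u)) * cos (exp (1 / u)) - c * (v\<^sup>2 * exp (- 1 / v)) * cos (exp (1 / v))\<bar> \<le> 6 * (v - u)"
  proof (rule key[where f = "\<lambda>x. c * (x\<^sup>2 * exp (- 1 / x)) * cos (exp (1 / x))" and C = "\<lambda>x. cos (exp (1 / x))" and D = "\<lambda>x. sin (exp (1 / x))"])
    fix x :: real assume x: "0 < x"
    show "((\<lambda>x. c * (x\<^sup>2 * exp (- 1 / x)) * cos (exp (1 / x))) has_real_derivative
      (2 * x * exp (- 1 / x) + exp (- 1 / x)) * c * cos (exp (1 / x)) + c * sin (exp (1 / x))) (at x)"
      using x ee[of x] by (auto intro!: derivative_eq_intros simp: field_simps power2_eq_square)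
  qed auto
  have 2: "\<bar>c * (u\<^sup>2 * exp (- 1 / u)) * sin (exp (1 / u)) - c * (v\<^sup>2 * exp (- 1 / v)) * sin (exp (1 / v))\<bar> \<le> 6 * (v - u)"
  proof (rule key[where f = "\<lambda>x. c * (x\<^sup>2 * exp (- 1 / x)) * sin (exp (1 / x))" and C = "\<lambda>x. sin (exp (1 / x))" and D = "\<lambda>x. - cos (exp (1 / x))"])
    fix x :: real assume x: "0 < x"
    show "((\<lambda>x. c * (x\<^sup>2 * exp (- 1 / x)) * sin (exp (1 / x))) has_real_derivative
      (2 * x * exp (- 1 / x) + exp (- 1 / x)) * c * sin (exp (1 / x)) + c * (- cos (exp (1 / x)))) (at x)"
      using x ee[of x] by (auto intro!: derivative_eq_intros simp: field_simps power2_eq_square)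
  qed auto
  have "dist (spiral_arm u) (spiral_arm v) \<le> \<bar>(spiral_arm u - spiral_arm v) $ 1\<bar> + \<bar>(spiral_arm u - spiral_arm v) $ 2\<bar>"
    unfolding dist_norm by (rule norm_vec2_le)
  also have "\<dots> \<le> 6 * (v - u) + 6 * (v - u)"
    using assms 1 2 by (intro add_mono) (simp_all add: n)
  finally show ?thesis by simp
qed

lemma spiral_arm_ln:
  "1 < t \<Longrightarrow> spiral_arm (1 / ln t) = polar (spiral_radius t) t"
  by (simp add: spiral_arm_def)

lemma eventually_less_at:
  fixes f g :: "'a::t2_space \<Rightarrow> real"
  shows "isCont f x \<Longrightarrow> isCont g x \<Longrightarrow> f x < g x \<Longrightarrow> \<forall>\<^sub>F y in nhds x. f y < g y"
  unfolding isCont_def tendsto_at_iff_tendsto_nhds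
  using order_tendstoD(1)[of "\<lambda>y. g y - f y" "g x - f x" "nhds x" 0]
  by (force intro: tendsto_diff)

text \<open>Off the positive half-axis the spiral is described by strict and non-strict inequalities between continuous
functions of the point, and between two consecutive edges all of these are strict; so a boundary point lies on the
outer edge, on the inner edge (which is the reflected outer edge, half a turn later), or on the half-axis
itself.\<close>

lemma frontier_spiral:
  assumes "x \<in> frontier spiral"
  obtains u where "0 < u" "u \<le> 1" "x = spiral_arm u \<or> x = - spiral_arm u \<or> x = polar (1 - u) 0"
proof -
  let ?K = "\<exists>u. 0 < u \<and> u \<le> 1 \<and> (x = spiral_arm u \<or> x = - spiral_arm u \<or> x = polar (1 - u) 0)"
  let ?g = spiral_radius
  have not_frontier: "x \<notin> frontier spiral" if "(\<forall>\<^sub>F y in nhds x. y \<in> spiral) \<or> (\<forall>\<^sub>F y in nhds x. y \<notin> spiral)"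
    using that
  proof
    assume "\<forall>\<^sub>F y in nhds x. y \<in> spiral"
    then have "x \<in> interior spiral" by (auto simp: eventually_nhds interior_def)
    then show ?thesis by (simp add: frontier_def)
  next
    assume "\<forall>\<^sub>F y in nhds x. y \<notin> spiral"
    then have "x \<in> interior (- spiral)" by (auto simp: eventually_nhds interior_def)
    then show ?thesis by (simp add: frontier_def interior_complement)
  qed
  have n1: "norm x \<le> 1 / 2"
  proof -
    have "closure spiral \<subseteq> cball 0 (1/2)" using spiral_subset_cball by (simp add: closure_minimal)
    then show ?thesis using assms by (auto simp: frontier_def)
  qed
  have onarm: ?K if t: "2 * pi \<le> t" and x: "x = polar (?g t) t \<or> x = - polar (?g t) t" for t
  proof -
    have t1: "3 < t" using t pi_bounds by linarith
    have "exp 1 < (3::real)" using e_less_272 by simp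
    with t1 have "1 \<le> ln t" by (subst ln_ge_iff) auto
    then have "0 < 1 / ln t" "1 / ln t \<le> 1" by auto
    then show ?K using x spiral_arm_ln[of t] t1 by (intro exI[of _ "1 / ln t"]) auto
  qed
  have ?K
  proof (cases "x \<in> pos_axis")
    case True
    then have 0: "0 \<le> x $ 1" "x $ 2 = 0" by (auto simp: pos_axis_def)
    then have "x $ 1 \<le> 1/2" using n1 by (simp add: norm_vec2)
    then show ?K using 0 by (intro exI[of _ "1 - x $ 1"]) (auto intro!: vec2_eqI)
  next
    case False
    define a where "a = angle x"
    have a: "0 \<le> a" "a < 2 * pi" using angle_bounds by (auto simp: a_def)
    have x0: "x \<noteq> 0" using False by (auto simp: pos_axis_def)
    have xp: "x = polar (norm x) a" by (simp add: a_def polar_angle)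
    have cont: "isCont (\<lambda>y. ?g (angle y + c)) x" if "2 \<le> c" for c
      using that a by (intro isCont_o2[of _ "\<lambda>y. angle y + c" ?g] continuous_intros continuous_angle[OF False] continuous_spiral_radius)
         (simp add: a_def)
    have contn: "isCont norm x" by (intro continuous_intros)
    note ev = eventually_less_at[OF cont contn] eventually_less_at[OF contn cont]
    \<comment> \<open>Between the half-turns \<open>m\<close> and \<open>m + 1\<close> a point is in the spiral for even \<open>m\<close> and in the gap for odd \<open>m\<close>.\<close>
    have notin: "y \<notin> spiral" if "?g (angle y + pi * (real m + 1)) < norm y" "norm y < ?g (angle y + pi * real m)"
      "odd m" for y m
    proof
      assume "y \<in> spiral"
      then obtain k::nat where k: "?g (angle y + 2 * pi * (real k + 1) + pi) \<le> norm y"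
        "norm y < ?g (angle y + 2 * pi * (real k + 1))" unfolding spiral_iff_angle by blast
      have p: "1 < angle y + pi * real j" if "j \<ge> 1" for j :: nat
        using angle_bounds(1)[of y] pi_bounds mult_mono[of 3 pi 1 "real j"] that by simp
      have "m \<ge> 1" using \<open>odd m\<close> by (cases m) auto
      show False
      proof (cases "2 * k + 3 \<le> m")
        case True
        then have "pi * real (2 * k + 3) \<le> pi * real m" by simp
        then have "angle y + 2 * pi * (real k + 1) + pi \<le> angle y + pi * real m" by (simp add: algebra_simps)
        moreover have "1 < angle y + 2 * pi * (real k + 1) + pi" using p[of "2*k+3"] by (simp add: algebra_simps)
        ultimately have "?g (angle y + pi * real m) \<le> ?g (angle y + 2 * pi * (real k + 1) + pi)"
          by (intro spiral_radius_antimono)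
        then show False using k that by linarith
      next
        case False
        then have "m + 1 \<le> 2 * k + 2" using \<open>odd m\<close> by presburger
        then have "pi * real (m + 1) \<le> pi * real (2 * k + 2)" by (intro mult_left_mono) (use of_nat_le_iff in blast, simp)
        then have "angle y + pi * (real m + 1) \<le> angle y + 2 * pi * (real k + 1)" by (simp add: algebra_simps)
        moreover have "1 < angle y + pi * (real m + 1)" using p[of "m + 1"] by (simp add: algebra_simps)
        ultimately have "?g (angle y + 2 * pi * (real k + 1)) \<le> ?g (angle y + pi * (real m + 1))"
          by (intro spiral_radius_antimono)
        then show False using k that by linarith
      qed
    qed
    have outer: "y \<notin> spiral" if "?g (angle y + 2 * pi) < norm y" for y
    proof
      assume "y \<in> spiral"
      then obtain k::nat where k: "norm y < ?g (angle y + 2 * pi * (real k + 1))" unfolding spiral_iff_angle by blast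
      have "2 * pi * 1 \<le> 2 * pi * (real k + 1)" by (intro mult_left_mono) auto
      then have "?g (angle y + 2 * pi * (real k + 1)) \<le> ?g (angle y + 2 * pi)"
        using angle_bounds(1)[of y] pi_bounds by (intro spiral_radius_antimono) auto
      then show False using k that by linarith
    qed
    have inside: "y \<in> spiral" if "?g (angle y + pi * (real m + 1)) < norm y" "norm y < ?g (angle y + pi * real m)"
      "even m" "m \<ge> 2" "y \<noteq> 0" for y m
    proof -
      obtain j where j: "m = 2 * j" using \<open>even m\<close> by blast
      define k where "k = j - 1"
      have m: "m = 2 * k + 2" using j \<open>m \<ge> 2\<close> by (simp add: k_def)
      show ?thesis unfolding spiral_iff_angle
        using that unfolding m by (intro conjI exI[of _ k]) (auto simp: algebra_simps)
    qed
    consider "?g (a + 2 * pi) < norm x" | "norm x = ?g (a + 2 * pi)" | "norm x < ?g (a + 2 * pi)" by linarith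
    then show ?K
    proof cases
      case 1
      have "\<forall>\<^sub>F y in nhds x. ?g (angle y + 2 * pi) < norm y"
        by (rule ev(1)) (use 1 pi_bounds in \<open>auto simp: a_def\<close>)
      then have "\<forall>\<^sub>F y in nhds x. y \<notin> spiral" by (rule eventually_mono) (rule outer)
      then show ?thesis using not_frontier assms by blast
    next
      case 2
      then have "x = polar (?g (a + 2 * pi)) (a + 2 * pi)" using xp by (intro vec2_eqI) (metis polar_nth(1) cos_periodic, metis polar_nth(2) sin_periodic)
      then show ?thesis using a by (intro onarm[of "a + 2 * pi"]) auto
    next
      case 3
      have "1 < a + 2 * pi" using a pi_bounds by linarith
      from spiral_radius_bracket[OF this pi_gt_zero _ 3]
      obtain n where n: "?g (a + 2 * pi + pi * (real n + 1)) \<le> norm x" "norm x < ?g (a + 2 * pi + pi * real n)"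
        using x0 by auto
      define m where "m = n + 2"
      have m: "?g (a + pi * (real m + 1)) \<le> norm x" "norm x < ?g (a + pi * real m)" "m \<ge> 2"
        using n by (simp_all add: m_def algebra_simps)
      have m3: "6 \<le> pi * real m" using mult_mono[of 3 pi 2 "real m"] m(3) pi_bounds by simp
      show ?thesis
      proof (cases "?g (a + pi * (real m + 1)) = norm x")
        case True
        let ?t = "a + pi * (real m + 1)"
        \<comment> \<open>The point lies on an edge; it is the outer one if \<open>m + 1\<close> is even, and otherwise its reflection.\<close>
        define \<sigma> :: real where "\<sigma> = (-1) ^ (m + 1)"
        have \<sigma>: "\<sigma> = 1 \<or> \<sigma> = -1" unfolding \<sigma>_def by (cases "even (m + 1)") auto
        have "cos (pi * (real m + 1)) = \<sigma>" "sin (pi * (real m + 1)) = 0"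
          using cos_npi2[of "m + 1"] sin_npi2[of "m + 1"] unfolding \<sigma>_def by (simp_all only: of_nat_add of_nat_1)
        then have "cos ?t = \<sigma> * cos a" "sin ?t = \<sigma> * sin a"
          unfolding cos_add sin_add by simp_all
        then have "polar (?g ?t) ?t = \<sigma> *\<^sub>R polar (norm x) a"
          unfolding True by (intro vec2_eqI) simp_all
        then have "polar (?g ?t) ?t = \<sigma> *\<^sub>R x" using xp by simp
        then have "x = polar (?g ?t) ?t \<or> x = - polar (?g ?t) ?t"
          using \<sigma> by auto
        moreover have "2 * pi \<le> pi * (real m + 1)" using mult_mono[of 2 "real m + 1" pi pi] m(3) by (simp add: mult.commute)
        then have "2 * pi \<le> ?t" using a(1) by linarith
        ultimately show ?K by (intro onarm[of ?t])
      next
        case False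
        have e1: "\<forall>\<^sub>F y in nhds x. ?g (angle y + pi * (real m + 1)) < norm y"
          by (rule ev(1)) (use False m m3 pi_bounds in \<open>auto simp: a_def algebra_simps\<close>)
        have e2: "\<forall>\<^sub>F y in nhds x. norm y < ?g (angle y + pi * real m)"
          by (rule ev(2)) (use m m3 in \<open>auto simp: a_def algebra_simps\<close>)
        have e3: "\<forall>\<^sub>F y in nhds x. 0 < norm y"
          by (rule eventually_less_at) (use x0 in auto)
        show ?K
        proof (cases "even m")
          case True
          have "\<forall>\<^sub>F y in nhds x. y \<in> spiral"
            using e1 e2 e3 by eventually_elim (rule inside[of _ m], use True m in auto)
          then show ?thesis using not_frontier assms by blast
        next
          case False
          have "\<forall>\<^sub>F y in nhds x. y \<notin> spiral"
            using e1 e2 by eventually_elim (rule notin[of _ m], use False in auto)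
          then show ?thesis using not_frontier assms by blast
        qed
      qed
    qed
  qed
  then show ?thesis using that by blast
qed

section \<open>Translates of the spiral and averages of its indicator\<close>

text \<open>For long translations the area of the spiral itself is a sufficient bound.\<close>

lemma spiral_translation_large:
  assumes "1 \<le> norm y"
  shows "(\<integral>\<^sup>+x. ennreal \<bar>indicator spiral (x - y) - indicator spiral x\<bar> \<partial>lborel) \<le> ennreal (4056 * norm y)"
proof -
  have "(\<integral>\<^sup>+x. ennreal \<bar>indicator spiral (x - y) - indicator spiral x\<bar> \<partial>lborel)
      \<le> (\<integral>\<^sup>+x. indicator (cball y (1/2)) x + indicator (cball 0 (1/2)) x \<partial>lborel)"
    using spiral_subset_cball
    by (intro nn_integral_mono) (auto simp: indicator_def dist_norm norm_minus_commute subset_iff)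
  also have "\<dots> = emeasure lborel (cball y (1/2)) + emeasure lborel (cball (0::real^2) (1/2))"
    by (subst nn_integral_add) (auto intro!: borel_measurable_indicator)
  also have "\<dots> = ennreal (pi * (1/2)\<^sup>2 + pi * (1/2)\<^sup>2)"
    by (simp add: emeasure_cball unit_ball_vol_2 flip: ennreal_plus)
  also have "\<dots> \<le> ennreal (4056 * norm y)"
    using pi_bounds assms by (intro ennreal_leI) (simp add: power2_eq_square)
  finally show ?thesis .
qed

text \<open>Finite perimeter. If exactly one of \<open>x\<close> and \<open>x - y\<close> belongs to the spiral, then the segment between them meets the
boundary, so that \<open>x\<close> lies in the \<open>|y|\<close>-neighbourhood of one of three Lipschitz curves.\<close>

lemma spiral_translation:
  "(\<integral>\<^sup>+x. ennreal \<bar>indicator spiral (x - y) - indicator spiral x\<bar> \<partial>lborel) \<le> ennreal (4056 * norm y)"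
proof -
  consider "y = 0" | "1 \<le> norm y" | "0 < norm y" "norm y \<le> 1" by force
  then show ?thesis
  proof cases
    case 1 then show ?thesis by simp
  next
    case 2 then show ?thesis by (rule spiral_translation_large)
  next
    case 3
    \<comment> \<open>All three curves are Lipschitz with constant 12; each contributes \<open>8 * (12 + 1)\<^sup>2 = 1352\<close>.\<close>
    have near: "\<exists>B. B \<in> sets borel \<and> {x. \<exists>u. 0 < u \<and> u \<le> 1 \<and> dist x (F u) \<le> norm y} \<subseteq> B \<and>
        emeasure lborel B \<le> ennreal (1352 * norm y)"
      if F: "\<And>u v. 0 < u \<Longrightarrow> u \<le> v \<Longrightarrow> v \<le> 2 \<Longrightarrow> dist (F u) (F v) \<le> 12 * (v - u)" for F :: "real \<Rightarrow> real^2"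
      by (rule emeasure_neighbourhood_Lipschitz_curve[of 12 F "norm y" "{x. \<exists>u. 0 < u \<and> u \<le> 1 \<and> dist x (F u) \<le> norm y}"])
         (use F 3 in auto)
    obtain B1 where B1: "B1 \<in> sets borel" "emeasure lborel B1 \<le> ennreal (1352 * norm y)"
      "{x. \<exists>u. 0 < u \<and> u \<le> 1 \<and> dist x (spiral_arm u) \<le> norm y} \<subseteq> B1"
      using near[of spiral_arm, OF spiral_arm_Lipschitz] by auto
    obtain B2 where B2: "B2 \<in> sets borel" "emeasure lborel B2 \<le> ennreal (1352 * norm y)"
      "{x. \<exists>u. 0 < u \<and> u \<le> 1 \<and> dist x (- spiral_arm u) \<le> norm y} \<subseteq> B2"
      using near[of "\<lambda>u. - spiral_arm u"] spiral_arm_Lipschitz by (auto simp: dist_minus)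
    have "dist (polar (1 - u) 0) (polar (1 - v) 0) \<le> 12 * (v - u)" if "u \<le> v" for u v
      using that by (simp add: dist_norm norm_vec2)
    then obtain B3 where B3: "B3 \<in> sets borel" "emeasure lborel B3 \<le> ennreal (1352 * norm y)"
      "{x. \<exists>u. 0 < u \<and> u \<le> 1 \<and> dist x (polar (1 - u) 0) \<le> norm y} \<subseteq> B3"
      using near[of "\<lambda>u. polar (1 - u) 0"] by auto
    have "x \<in> B1 \<union> B2 \<union> B3" if x: "(x - y \<in> spiral) \<noteq> (x \<in> spiral)" for x
    proof -
      have "closed_segment x (x - y) \<inter> frontier spiral \<noteq> {}"
        using x by (intro connected_Int_frontier) auto
      then obtain b where b: "b \<in> closed_segment x (x - y)" "b \<in> frontier spiral" by blast
      have d: "dist x b \<le> norm y"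
        using dist_in_closed_segment[OF b(1)] by (simp add: dist_norm norm_minus_commute)
      show ?thesis
        using frontier_spiral[OF b(2)] d B1(3) B2(3) B3(3) by (smt (verit) UnCI mem_Collect_eq subset_iff)
    qed
    then have "(\<integral>\<^sup>+x. ennreal \<bar>indicator spiral (x - y) - indicator spiral x\<bar> \<partial>lborel)
        \<le> (\<integral>\<^sup>+x. indicator (B1 \<union> B2 \<union> B3) x \<partial>lborel)"
      by (intro nn_integral_mono) (auto simp: indicator_def)
    also have "\<dots> = emeasure lborel (B1 \<union> B2 \<union> B3)"
      using B1 B2 B3 by (intro nn_integral_indicator) auto
    also have "\<dots> \<le> emeasure lborel (B1 \<union> B2) + emeasure lborel B3"
      using B1 B2 B3 by (intro emeasure_subadditive) auto
    also have "\<dots> \<le> (emeasure lborel B1 + emeasure lborel B2) + emeasure lborel B3"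
      using B1 B2 B3 by (intro add_mono emeasure_subadditive) auto
    also have "\<dots> \<le> (ennreal (1352 * norm y) + ennreal (1352 * norm y)) + ennreal (1352 * norm y)"
      by (intro add_mono B1 B2 B3)
    also have "\<dots> = ennreal (4056 * norm y)" by (simp flip: ennreal_plus)
    finally show ?thesis .
  qed
qed

text \<open>This is the convolution of the indicator of the spiral with \<open>\<delta>\<^sup>-\<^sup>2 \<phi> (\<cdot> / \<delta>)\<close> after the substitution
\<open>y = x - \<delta> w\<close>, which moves the dilation from \<open>\<phi>\<close> to the spiral. So the same \<open>\<phi>\<close> serves all scales
in the limit arguments.\<close>

definition spiral_conv :: "(real^2 \<Rightarrow> complex) \<Rightarrow> real \<Rightarrow> real^2 \<Rightarrow> complex" where
  "spiral_conv \<phi> \<delta> x = (\<integral>w. \<phi> w * indicator spiral (x - \<delta> *\<^sub>R w) \<partial>lborel)"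

lemma borel_measurable_spiral_conv [measurable]:
  assumes [measurable]: "\<phi> \<in> borel_measurable borel"
  shows "spiral_conv \<phi> \<delta> \<in> borel_measurable borel"
proof -
  have "(\<lambda>x. \<integral>w. \<phi> w * indicator spiral (x - \<delta> *\<^sub>R w) \<partial>lborel) \<in> borel_measurable lborel"
    by (rule lborel.borel_measurable_lebesgue_integral) measurable
  then show ?thesis by (simp add: spiral_conv_def [abs_def])
qed

lemma integrable_mult_indicator_spiral:
  assumes "integrable lborel \<phi>"
  shows "integrable lborel (\<lambda>w. \<phi> w * indicator spiral (x - \<delta> *\<^sub>R w) :: complex)"
proof -
  have [measurable]: "\<phi> \<in> borel_measurable borel" using assms by auto
  show ?thesis
    by (rule Bochner_Integration.integrable_bound[OF assms]) (auto simp: indicator_def)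
qed

lemma norm_spiral_conv_le:
  assumes "integrable lborel \<phi>"
  shows "norm (spiral_conv \<phi> \<delta> x) \<le> (\<integral>w. norm (\<phi> w) \<partial>lborel)"
proof -
  have "norm (spiral_conv \<phi> \<delta> x) \<le> (\<integral>w. norm (\<phi> w * indicator spiral (x - \<delta> *\<^sub>R w)) \<partial>lborel)"
    unfolding spiral_conv_def by (rule integral_norm_bound)
  also have "\<dots> \<le> (\<integral>w. norm (\<phi> w) \<partial>lborel)"
    using assms integrable_mult_indicator_spiral[OF assms]
    by (intro integral_mono integrable_norm) (auto simp: indicator_def)
  finally show ?thesis .
qed

lemma spiral_conv_L1_trivial:
  assumes "integrable lborel \<phi>"
  shows "(\<integral>\<^sup>+x. ennreal (norm (spiral_conv \<phi> \<delta> x)) \<partial>lborel) \<le> ennreal (\<integral>w. norm (\<phi> w) \<partial>lborel)"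
proof -
  have [measurable]: "\<phi> \<in> borel_measurable borel" using assms by auto
  have "(\<integral>\<^sup>+x. ennreal (norm (spiral_conv \<phi> \<delta> x)) \<partial>lborel)
      \<le> (\<integral>\<^sup>+x. \<integral>\<^sup>+w. ennreal (norm (\<phi> w)) * indicator spiral (x - \<delta> *\<^sub>R w) \<partial>lborel \<partial>lborel)"
  proof (rule nn_integral_mono)
    fix x :: "real^2"
    have "ennreal (norm (spiral_conv \<phi> \<delta> x)) \<le> (\<integral>\<^sup>+w. norm (\<phi> w * indicator spiral (x - \<delta> *\<^sub>R w)) \<partial>lborel)"
      unfolding spiral_conv_def by (intro integral_norm_bound_ennreal integrable_mult_indicator_spiral assms)
    also have "\<dots> = (\<integral>\<^sup>+w. ennreal (norm (\<phi> w)) * indicator spiral (x - \<delta> *\<^sub>R w) \<partial>lborel)"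
      by (intro nn_integral_cong) (auto simp: indicator_def)
    finally show "ennreal (norm (spiral_conv \<phi> \<delta> x)) \<le> \<dots>" .
  qed
  also have "\<dots> = (\<integral>\<^sup>+w. \<integral>\<^sup>+x. ennreal (norm (\<phi> w)) * indicator spiral (x - \<delta> *\<^sub>R w) \<partial>lborel \<partial>lborel)"
    by (rule lborel_pair.Fubini') measurable
  also have "\<dots> \<le> (\<integral>\<^sup>+w. ennreal (norm (\<phi> w)) * 1 \<partial>lborel)"
  proof (rule nn_integral_mono)
    fix w :: "real^2"
    have "(\<integral>\<^sup>+x. indicator spiral (x - \<delta> *\<^sub>R w) \<partial>lborel) \<le> (\<integral>\<^sup>+x. indicator (cball (\<delta> *\<^sub>R w) (1/2)) x \<partial>lborel)"
      using spiral_subset_cball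
      by (intro nn_integral_mono) (auto simp: indicator_def dist_norm norm_minus_commute subset_iff)
    also have "\<dots> = ennreal (pi * (1/2)\<^sup>2)" by (simp add: emeasure_cball unit_ball_vol_2)
    also have "\<dots> \<le> 1" using pi_bounds by (simp add: power2_eq_square)
    finally show "(\<integral>\<^sup>+x. ennreal (norm (\<phi> w)) * indicator spiral (x - \<delta> *\<^sub>R w) \<partial>lborel) \<le> ennreal (norm (\<phi> w)) * 1"
      using mult_left_mono[of "\<integral>\<^sup>+x. indicator spiral (x - \<delta> *\<^sub>R w) \<partial>lborel" 1 "ennreal (norm (\<phi> w))"]
      by (subst nn_integral_cmult) auto
  qed
  also have "\<dots> = ennreal (\<integral>w. norm (\<phi> w) \<partial>lborel)"
    using assms by (simp add: nn_integral_eq_integral)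
  finally show ?thesis .
qed

text \<open>As \<open>\<phi>\<close> has mean zero, the indicator at \<open>x - \<delta> w\<close> may be replaced by its difference to the indicator at \<open>x\<close>,
whose \<open>L\<^sup>1\<close> norm is controlled by the translation estimate.\<close>

lemma spiral_conv_L1_cancellation:
  assumes int: "integrable lborel \<phi>" "integrable lborel (\<lambda>w. norm w * norm (\<phi> w))"
    and mean: "(\<integral>w. \<phi> w \<partial>lborel) = 0" and \<delta>: "0 \<le> \<delta>"
  shows "(\<integral>\<^sup>+x. ennreal (norm (spiral_conv \<phi> \<delta> x)) \<partial>lborel) \<le> ennreal (4056 * \<delta> * (\<integral>w. norm w * norm (\<phi> w) \<partial>lborel))"
proof -
  have [measurable]: "\<phi> \<in> borel_measurable borel" using int by auto
  have "(\<integral>\<^sup>+x. ennreal (norm (spiral_conv \<phi> \<delta> x)) \<partial>lborel)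
      \<le> (\<integral>\<^sup>+x. \<integral>\<^sup>+w. ennreal (norm (\<phi> w)) * ennreal \<bar>indicator spiral (x - \<delta> *\<^sub>R w) - indicator spiral x\<bar> \<partial>lborel \<partial>lborel)"
  proof (rule nn_integral_mono)
    fix x :: "real^2"
    have i: "integrable lborel (\<lambda>w. \<phi> w * indicator spiral (x - \<delta> *\<^sub>R w) - \<phi> w * indicator spiral x)"
      by (intro Bochner_Integration.integrable_diff integrable_mult_indicator_spiral integrable_mult_left int)
    have "spiral_conv \<phi> \<delta> x = (\<integral>w. \<phi> w * indicator spiral (x - \<delta> *\<^sub>R w) - \<phi> w * indicator spiral x \<partial>lborel)"
      using mean int unfolding spiral_conv_def
      by (subst Bochner_Integration.integral_diff) (auto intro!: integrable_mult_indicator_spiral)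
    then have "ennreal (norm (spiral_conv \<phi> \<delta> x)) \<le> (\<integral>\<^sup>+w. norm (\<phi> w * indicator spiral (x - \<delta> *\<^sub>R w) - \<phi> w * indicator spiral x) \<partial>lborel)"
      using integral_norm_bound_ennreal[OF i] by simp
    also have "\<dots> = (\<integral>\<^sup>+w. ennreal (norm (\<phi> w)) * ennreal \<bar>indicator spiral (x - \<delta> *\<^sub>R w) - indicator spiral x\<bar> \<partial>lborel)"
      by (intro nn_integral_cong) (auto simp: indicator_def)
    finally show "ennreal (norm (spiral_conv \<phi> \<delta> x)) \<le> \<dots>" .
  qed
  also have "\<dots> = (\<integral>\<^sup>+w. \<integral>\<^sup>+x. ennreal (norm (\<phi> w)) * ennreal \<bar>indicator spiral (x - \<delta> *\<^sub>R w) - indicator spiral x\<bar> \<partial>lborel \<partial>lborel)"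
    by (rule lborel_pair.Fubini') measurable
  also have "\<dots> \<le> (\<integral>\<^sup>+w. ennreal (4056 * \<delta>) * ennreal (norm w * norm (\<phi> w)) \<partial>lborel)"
  proof (rule nn_integral_mono)
    fix w :: "real^2"
    have "(\<integral>\<^sup>+x. ennreal (norm (\<phi> w)) * ennreal \<bar>indicator spiral (x - \<delta> *\<^sub>R w) - indicator spiral x\<bar> \<partial>lborel)
        = ennreal (norm (\<phi> w)) * (\<integral>\<^sup>+x. ennreal \<bar>indicator spiral (x - \<delta> *\<^sub>R w) - indicator spiral x\<bar> \<partial>lborel)"
      by (rule nn_integral_cmult) measurable
    also have "\<dots> \<le> ennreal (norm (\<phi> w)) * ennreal (4056 * norm (\<delta> *\<^sub>R w))"
      by (intro mult_left_mono spiral_translation) auto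
    also have "\<dots> = ennreal (4056 * \<delta>) * ennreal (norm w * norm (\<phi> w))"
      using \<delta> by (simp add: ennreal_mult' [symmetric] mult_ac)
    finally show "(\<integral>\<^sup>+x. ennreal (norm (\<phi> w)) * ennreal \<bar>indicator spiral (x - \<delta> *\<^sub>R w) - indicator spiral x\<bar> \<partial>lborel) \<le> \<dots>" .
  qed
  also have "\<dots> = ennreal (4056 * \<delta>) * ennreal (\<integral>w. norm w * norm (\<phi> w) \<partial>lborel)"
    using int(2) by (subst nn_integral_cmult) (auto simp: nn_integral_eq_integral)
  also have "\<dots> = ennreal (4056 * \<delta> * (\<integral>w. norm w * norm (\<phi> w) \<partial>lborel))"
    using \<delta> by (simp add: ennreal_mult'')
  finally show ?thesis .
qed

section \<open>Blow-up at the outer edge\<close>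

text \<open>The derivative of \<open>g\<close> is \<open>- (g t / t) (1 + 2 / ln t)\<close>, and \<open>ln t \<ge> 1\<close> for \<open>t \<ge> 3\<close>.\<close>

lemma spiral_radius_Lipschitz:
  assumes "3 \<le> a" "a \<le> x" "a \<le> y"
  shows "\<bar>spiral_radius x - spiral_radius y\<bar> \<le> 3 * (spiral_radius a / a) * \<bar>x - y\<bar>"
proof -
  have 1: "1 \<le> ln z" if "3 \<le> z" for z :: real
  proof -
    have "exp 1 < (3::real)" using e_less_272 by simp
    with that show ?thesis by (subst ln_ge_iff) auto
  qed
  have main: "spiral_radius x - spiral_radius y \<le> 3 * (spiral_radius a / a) * (y - x)" if xy: "x < y" "a \<le> x" for x y
  proof -
    have d: "(spiral_radius has_real_derivative - (spiral_radius z / z * ((ln z + 2) / ln z))) (at z)" if "x \<le> z" for z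
    proof -
      have z: "3 \<le> z" "1 \<le> ln z" using that xy assms 1[of z] by auto
      then show ?thesis unfolding spiral_radius_def[abs_def] log_def
        by (auto intro!: derivative_eq_intros simp: field_simps power2_eq_square)
    qed
    obtain z where z: "x < z" "z < y"
      and eq: "spiral_radius y - spiral_radius x = (y - x) * - (spiral_radius z / z * ((ln z + 2) / ln z))"
      using MVT2[OF xy(1), of spiral_radius "\<lambda>z. - (spiral_radius z / z * ((ln z + 2) / ln z))"] d by blast
    have z3: "a \<le> z" "3 \<le> z" using z xy assms by auto
    have pos: "0 < spiral_radius z" "0 < spiral_radius a" using z3 assms by (auto intro: spiral_radius_pos)
    have "spiral_radius z / z \<le> spiral_radius a / a"
      using z3 assms pos by (intro frac_le spiral_radius_antimono) auto
    moreover have "(ln z + 2) / ln z \<le> 3" using 1[OF z3(2)] by (simp add: field_simps)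
    ultimately have "spiral_radius z / z * ((ln z + 2) / ln z) \<le> spiral_radius a / a * 3"
      using 1[OF z3(2)] pos assms by (intro mult_mono) auto
    then have "(y - x) * (spiral_radius z / z * ((ln z + 2) / ln z)) \<le> (y - x) * (spiral_radius a / a * 3)"
      using xy by (intro mult_left_mono) auto
    then show ?thesis using eq by (simp add: algebra_simps)
  qed
  consider "x < y" | "x = y" | "y < x" by linarith
  then show ?thesis
  proof cases
    case 1
    then show ?thesis using main[of x y] assms spiral_radius_antimono[of x y] by simp
  next
    case 3
    then show ?thesis using main[of y x] assms spiral_radius_antimono[of y x] by simp
  qed simp
qed

lemma abs_arctan_le: "\<bar>arctan x\<bar> \<le> \<bar>x\<bar>"
proof -
  have *: "arctan x \<le> x" if "0 < x" for x :: real
  proof -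
    obtain z where "arctan x - arctan 0 = (x - 0) * inverse (1 + z\<^sup>2)"
      using MVT2[OF \<open>0 < x\<close>, of arctan "\<lambda>z. inverse (1 + z\<^sup>2)"] DERIV_arctan by metis
    moreover have "inverse (1 + z\<^sup>2) \<le> 1" by (simp add: inverse_le_1_iff)
    ultimately show ?thesis using that mult_left_mono[of "inverse (1 + z\<^sup>2)" 1 x] by simp
  qed
  show ?thesis
    using *[of x] *[of "-x"] by (cases "x = 0"; cases "0 < x") (auto simp: arctan_minus abs_if)
qed

lemma polar_in_spiral:
  assumes "2 * pi \<le> \<alpha>" "spiral_radius (\<alpha> + pi) \<le> r" "r < spiral_radius \<alpha>"
  shows "polar r \<alpha> \<in> spiral"
proof -
  have "0 < spiral_radius (\<alpha> + pi)" using assms pi_bounds by (intro spiral_radius_pos) auto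
  then have "0 < r" using assms by linarith
  then show ?thesis using assms by (subst polar_in_spiral_iff) (auto intro!: exI[of _ "0::int"])
qed

lemma polar_notin_spiral:
  assumes "3 * pi \<le> \<alpha>" "spiral_radius \<alpha> \<le> r" "r < spiral_radius (\<alpha> - pi)"
  shows "polar r \<alpha> \<notin> spiral"
proof
  assume "polar r \<alpha> \<in> spiral"
  moreover have "0 < spiral_radius \<alpha>" using assms pi_bounds by (intro spiral_radius_pos) auto
  then have "0 < r" using assms by linarith
  ultimately obtain k :: int where k: "2 * pi \<le> \<alpha> + 2 * pi * k"
      "spiral_radius (\<alpha> + 2 * pi * k + pi) \<le> r" "r < spiral_radius (\<alpha> + 2 * pi * k)"
    by (subst (asm) polar_in_spiral_iff) auto
  show False
  proof (cases "0 \<le> k")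
    case True
    then have "spiral_radius (\<alpha> + 2 * pi * k) \<le> spiral_radius \<alpha>"
      using assms pi_bounds by (intro spiral_radius_antimono) auto
    then show False using assms k by linarith
  next
    case False
    then have "2 * pi * real_of_int k \<le> 2 * pi * (- 1)" by (intro mult_left_mono) auto
    then have "spiral_radius (\<alpha> - pi) \<le> spiral_radius (\<alpha> + 2 * pi * k + pi)"
      using k pi_bounds by (intro spiral_radius_antimono) auto
    then show False using assms k by linarith
  qed
qed

text \<open>Zooming in by the factor \<open>1 / \<delta>\<close> at the point of the outer edge with angle \<open>t\<close>, in coordinates \<open>a\<close> (radial) and
\<open>q\<close> (tangential): if \<open>\<delta>\<close> is of the order of \<open>g\<^sup>2\<close> at most, only the half-plane \<open>a < 0\<close> is visible. There are
three reasons. The curvature of the edge is about \<open>1 / g\<close>, so that it bends by \<open>\<delta>\<^sup>2 / g\<close>, which is small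
compared to \<open>\<delta>\<close>. The radius of the edge changes by about \<open>g / t\<close> per unit of angle, so that over the angle
\<open>\<delta> / g\<close> it changes by \<open>\<delta> / t\<close>. The other edges have a distance of about \<open>g / t = g\<^sup>2 (log t)\<^sup>2\<close>, which is
large compared to \<open>\<delta>\<close>.\<close>

lemma spiral_blowup:
  assumes \<epsilon>: "0 < \<epsilon>" and B: "0 < B"
  shows "\<forall>\<^sub>F t in at_top. \<forall>\<delta> a q. 0 < \<delta> \<and> \<delta> \<le> 16 * (spiral_radius t)\<^sup>2 \<and> \<epsilon> \<le> \<bar>a\<bar> \<and> \<bar>a\<bar> \<le> B \<and> \<bar>q\<bar> \<le> B \<longrightarrow>
    (polar (spiral_radius t) t + \<delta> *\<^sub>R (polar a t + polar q (t + pi / 2)) \<in> spiral \<longleftrightarrow> a < 0)"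
proof -
  let ?g = spiral_radius
  have "((\<lambda>t. ?g (t - 1) / (t - 1) / ?g t) \<longlongrightarrow> 0) at_top"
    unfolding spiral_radius_def by real_asymp
  note lim = tendsto_mult_right_zero[OF spiral_radius_tendsto_0, of "32 * B"]
    tendsto_mult_right_zero[OF spiral_radius_tendsto_0, of "32 * B\<^sup>2"]
    tendsto_mult_right_zero[OF this, of "6 * B"]
  \<comment> \<open>An angle of 2 on either side is less than a half-turn even after a perturbation by \<open>\<beta>\<close> with \<open>|\<beta>| < 1\<close>.\<close>
  have inf1: "filterlim (\<lambda>t. (?g t - ?g (t + 2)) / (?g t)\<^sup>2) at_top at_top"
    unfolding spiral_radius_def by real_asymp
  have "filterlim (\<lambda>t::real. t - 2) at_top at_top" by real_asymp
  from filterlim_compose[OF inf1 this]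
  have inf2: "filterlim (\<lambda>t. (?g (t - 2) - ?g t) / (?g (t - 2))\<^sup>2) at_top at_top"
    by simp
  have "\<forall>\<^sub>F t in at_top. 32 * B * ?g t < 1"
    using order_tendstoD(2)[OF lim(1), of 1] by simp
  moreover have "\<forall>\<^sub>F t in at_top. 32 * B\<^sup>2 * ?g t < \<epsilon> / 4"
    using order_tendstoD(2)[OF lim(2), of "\<epsilon> / 4"] \<epsilon> by simp
  moreover have "\<forall>\<^sub>F t in at_top. 6 * B * (?g (t - 1) / (t - 1) / ?g t) < \<epsilon> / 4"
    using order_tendstoD(2)[OF lim(3), of "\<epsilon> / 4"] \<epsilon> by simp
  moreover have "\<forall>\<^sub>F t in at_top. 16 * (B + \<epsilon> + 1) \<le> (?g t - ?g (t + 2)) / (?g t)\<^sup>2"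
    "\<forall>\<^sub>F t in at_top. 16 * (B + \<epsilon> + 1) \<le> (?g (t - 2) - ?g t) / (?g (t - 2))\<^sup>2"
    using inf1 inf2 unfolding filterlim_at_top by blast+
  moreover have "\<forall>\<^sub>F t in at_top. (20::real) \<le> t" by (rule eventually_ge_at_top)
  ultimately show ?thesis
  proof (eventually_elim, intro allI impI, elim conjE)
    fix t \<delta> a q
    assume e1: "32 * B * ?g t < 1" and e2: "32 * B\<^sup>2 * ?g t < \<epsilon> / 4"
      and e3: "6 * B * (?g (t - 1) / (t - 1) / ?g t) < \<epsilon> / 4"
      and e4: "16 * (B + \<epsilon> + 1) \<le> (?g t - ?g (t + 2)) / (?g t)\<^sup>2"
      and e5: "16 * (B + \<epsilon> + 1) \<le> (?g (t - 2) - ?g t) / (?g (t - 2))\<^sup>2"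
      and t: "20 \<le> t" and \<delta>: "0 < \<delta>" "\<delta> \<le> 16 * (?g t)\<^sup>2"
      and a: "\<epsilon> \<le> \<bar>a\<bar>" "\<bar>a\<bar> \<le> B" and q: "\<bar>q\<bar> \<le> B"
    define g where "g = ?g t"
    have g: "0 < g" using t by (auto simp: g_def intro: spiral_radius_pos)
    have \<delta>B: "\<delta> * B \<le> 16 * g\<^sup>2 * B" using \<delta> B by (simp add: g_def)
    have "16 * g\<^sup>2 * B = g * (32 * B * g) / 2" by (simp add: power2_eq_square)
    also have "\<dots> \<le> g * 1 / 2" using e1 g by (intro divide_right_mono mult_left_mono) (auto simp: g_def)
    finally have \<delta>Bg: "\<delta> * B \<le> g / 2" using \<delta>B by simp
    \<comment> \<open>In the frame rotated by \<open>t\<close> the point is \<open>(R, \<delta> q)\<close>, with polar coordinates \<open>\<rho>\<close> and \<open>\<beta>\<close>.\<close>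
    define R where "R = g + \<delta> * a"
    have "\<bar>\<delta> * a\<bar> \<le> \<delta> * B" using a \<delta> by (simp add: abs_mult)
    then have R: "g / 2 \<le> R" "R \<le> g + \<delta> * B" "g - \<delta> * B \<le> R" using \<delta>Bg unfolding R_def by linarith+
    have R0: "0 < R" using R g by linarith
    define y where "y = \<delta> * q / R"
    have "\<bar>\<delta> * q\<bar> \<le> \<delta> * B" using q \<delta> by (simp add: abs_mult)
    then have "\<bar>y\<bar> \<le> \<delta> * B / (g / 2)" unfolding y_def abs_divide
      using R R0 g by (intro frac_le) auto
    then have y: "\<bar>y\<bar> \<le> 2 * \<delta> * B / g" by (simp add: mult_ac)
    have "2 * \<delta> * B / g \<le> 2 * (16 * g\<^sup>2 * B) / g" using \<delta>B g by (intro divide_right_mono; linarith)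
    also have "\<dots> = 32 * B * g" using g by (simp add: power2_eq_square)
    finally have y32: "2 * \<delta> * B / g \<le> 32 * B * g" .
    define \<beta> where "\<beta> = arctan y"
    have \<beta>: "\<bar>\<beta>\<bar> \<le> \<bar>y\<bar>" unfolding \<beta>_def by (rule abs_arctan_le)
    have \<beta>1: "\<bar>\<beta>\<bar> < 1" using \<beta> y y32 e1 by (simp add: g_def)
    define \<rho> where "\<rho> = R * sqrt (1 + y\<^sup>2)"
    have s: "1 \<le> sqrt (1 + y\<^sup>2)" "sqrt (1 + y\<^sup>2) \<le> 1 + y\<^sup>2" "sqrt (1 + y\<^sup>2) \<noteq> 0"
      by (auto intro!: real_le_lsqrt simp: power2_sum add_nonneg_eq_0_iff)
    have \<rho>cs: "\<rho> * cos \<beta> = R" "\<rho> * sin \<beta> = \<delta> * q"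
      using R0 s(3) by (simp_all add: \<rho>_def \<beta>_def cos_arctan sin_arctan y_def)
    have \<rho>1: "R \<le> \<rho>" using R0 s(1) by (simp add: \<rho>_def)
    have "\<rho> \<le> R * (1 + y\<^sup>2)" using R0 s(2) by (simp add: \<rho>_def)
    also have "\<dots> = R + \<delta> * q * y" using R0 by (simp add: y_def power2_eq_square field_simps)
    also have "\<delta> * q * y \<le> (\<delta> * B) * (32 * B * g)"
    proof -
      have "\<delta> * q * y \<le> \<bar>\<delta> * q\<bar> * \<bar>y\<bar>" by (metis abs_ge_self abs_mult)
      also have "\<dots> \<le> (\<delta> * B) * (32 * B * g)"
        using \<open>\<bar>\<delta> * q\<bar> \<le> \<delta> * B\<close> y y32 \<delta> B by (intro mult_mono) auto
      finally show ?thesis .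
    qed
    also have "(\<delta> * B) * (32 * B * g) = \<delta> * (32 * B\<^sup>2 * g)" by (simp add: power2_eq_square)
    also have "\<dots> \<le> \<delta> * (\<epsilon> / 4)" using e2 \<delta> by (intro mult_left_mono) (auto simp: g_def)
    finally have \<rho>2: "\<rho> \<le> R + \<delta> * \<epsilon> / 4" by simp
    have point: "polar (?g t) t + \<delta> *\<^sub>R (polar a t + polar q (t + pi / 2)) = polar \<rho> (t + \<beta>)"
    proof -
      have "polar \<rho> (t + \<beta>) $ 1 = (\<rho> * cos \<beta>) * cos t - (\<rho> * sin \<beta>) * sin t"
        "polar \<rho> (t + \<beta>) $ 2 = (\<rho> * cos \<beta>) * sin t + (\<rho> * sin \<beta>) * cos t"
        by (simp_all add: cos_add sin_add algebra_simps)
      then show ?thesis unfolding \<rho>cs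
        by (intro vec2_eqI) (simp_all add: R_def g_def cos_add sin_add algebra_simps)
    qed
    have "\<bar>?g (t + \<beta>) - ?g t\<bar> \<le> 3 * (?g (t - 1) / (t - 1)) * \<bar>t + \<beta> - t\<bar>"
      using t \<beta>1 by (intro spiral_radius_Lipschitz) auto
    also have "\<dots> \<le> 3 * (?g (t - 1) / (t - 1)) * (2 * \<delta> * B / g)"
      using t \<beta> y by (intro mult_left_mono) (auto intro!: mult_nonneg_nonneg divide_nonneg_nonneg less_imp_le[OF spiral_radius_pos])
    also have "\<dots> = \<delta> * (6 * B * (?g (t - 1) / (t - 1) / ?g t))" by (simp add: g_def)
    also have "\<dots> \<le> \<delta> * (\<epsilon> / 4)" using e3 \<delta> by (intro mult_left_mono) auto
    finally have close: "\<bar>?g (t + \<beta>) - g\<bar> \<le> \<delta> * \<epsilon> / 4" by (simp add: g_def)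
    have "\<delta> * (B + \<epsilon> + 1) \<le> 16 * g\<^sup>2 * (B + \<epsilon> + 1)"
      using \<delta> B \<epsilon> by (intro mult_right_mono) (auto simp: g_def)
    moreover have "16 * (B + \<epsilon> + 1) * g\<^sup>2 \<le> 16 * (B + \<epsilon> + 1) * (?g (t - 2))\<^sup>2"
      using t g B \<epsilon> unfolding g_def by (intro mult_left_mono power_mono spiral_radius_antimono) auto
    moreover have "0 < ?g (t - 2)" using t by (intro spiral_radius_pos) auto
    then have "16 * (B + \<epsilon> + 1) * g\<^sup>2 \<le> g - ?g (t + 2)" "16 * (B + \<epsilon> + 1) * (?g (t - 2))\<^sup>2 \<le> ?g (t - 2) - g"
      using e4 e5 g by (simp_all add: g_def pos_le_divide_eq)
    ultimately have gap: "\<delta> * B + \<delta> * \<epsilon> + \<delta> \<le> g - ?g (t + 2)" "\<delta> * B + \<delta> * \<epsilon> + \<delta> \<le> ?g (t - 2) - g"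
      by (simp_all add: algebra_simps)
    have \<delta>\<epsilon>: "0 < \<delta> * \<epsilon>" using \<delta> \<epsilon> by simp
    show "polar (?g t) t + \<delta> *\<^sub>R (polar a t + polar q (t + pi / 2)) \<in> spiral \<longleftrightarrow> a < 0"
    proof (cases "a < 0")
      case True
      then have "\<delta> * a \<le> \<delta> * (- \<epsilon>)" using a \<delta> by (intro mult_left_mono) auto
      then have "\<delta> * a \<le> - (\<delta> * \<epsilon>)" by simp
      then have u: "\<rho> < ?g (t + \<beta>)" using \<rho>2 close \<delta>\<epsilon> unfolding R_def by linarith
      have "?g (t + \<beta> + pi) \<le> ?g (t + 2)" using t \<beta>1 pi_bounds by (intro spiral_radius_antimono) auto
      then have "?g (t + \<beta> + pi) \<le> \<rho>" using \<rho>1 R gap \<delta>\<epsilon> \<delta> by linarith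
      then have "polar \<rho> (t + \<beta>) \<in> spiral" using u t \<beta>1 pi_bounds by (intro polar_in_spiral) auto
      then show ?thesis using True point by simp
    next
      case False
      then have "\<delta> * \<epsilon> \<le> \<delta> * a" using a \<delta> by (intro mult_left_mono) auto
      then have l: "?g (t + \<beta>) \<le> \<rho>" using \<rho>1 close \<delta>\<epsilon> unfolding R_def by linarith
      have "?g (t - 2) \<le> ?g (t + \<beta> - pi)" using t \<beta>1 pi_bounds by (intro spiral_radius_antimono) auto
      then have "\<rho> < ?g (t + \<beta> - pi)" using \<rho>2 R gap \<delta>\<epsilon> \<delta> by linarith
      then have "polar \<rho> (t + \<beta>) \<notin> spiral" using l t \<beta>1 pi_bounds by (intro polar_notin_spiral) auto
      then show ?thesis using False point by simp
    qed
  qed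
qed

section \<open>Half-plane integrals and a local lower bound\<close>

text \<open>The positive and the negative part of \<open>f\<close> induce two finite measures on the line, by projection to the first
coordinate. They agree on all open half-lines and so they coincide.\<close>

lemma halfspace_integrals_determine:
  fixes f :: "real^2 \<Rightarrow> real" and h :: "real \<Rightarrow> complex"
  assumes f: "integrable lborel f"
    and z: "\<And>a. (\<integral>w. f w * indicator {w. a < w $ 1} w \<partial>lborel) = 0"
    and h [measurable]: "h \<in> borel_measurable borel" and h1: "\<And>x. norm (h x) \<le> 1"
  shows "(\<integral>w. f w *\<^sub>R h (w $ 1) \<partial>lborel) = 0"
proof -
  have [measurable]: "f \<in> borel_measurable borel" using f by auto
  have [measurable]: "(\<lambda>w::real^2. w $ 1) \<in> borel_measurable borel"
    by (intro borel_measurable_continuous_onI continuous_intros)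
  have half [measurable]: "{w::real^2. a < w $ 1} \<in> sets borel" for a by measurable
  define M where "M g = distr (density lborel (\<lambda>w. ennreal (g w))) borel (\<lambda>w::real^2. w $ 1)" for g
  define p where "p w = max 0 (f w)" for w
  define n where "n w = max 0 (- f w)" for w
  have [measurable]: "p \<in> borel_measurable borel" "n \<in> borel_measurable borel"
    unfolding p_def [abs_def] n_def [abs_def] by measurable
  have pn: "0 \<le> p w" "0 \<le> n w" "f w = p w - n w" for w by (auto simp: p_def n_def)
  have ip: "integrable lborel p" and in_: "integrable lborel n"
    by (rule Bochner_Integration.integrable_bound[OF f]; auto simp: p_def n_def)+
  have ind: "integrable lborel (\<lambda>w. g w * indicator {w. a < w $ 1} w)" if "integrable lborel g" for g :: "real^2 \<Rightarrow> real" and a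
    using integrable_mult_indicator[OF _ that, of "{w. a < w $ 1}"] by (simp add: mult.commute)
  have em: "emeasure (M g) {a<..} = ennreal (\<integral>w. g w * indicator {w. a < w $ 1} w \<partial>lborel)"
    if g: "integrable lborel g" "\<And>w. 0 \<le> g w" for g a
  proof -
    have [measurable]: "g \<in> borel_measurable borel" using g by auto
    have "emeasure (M g) {a<..} = emeasure (density lborel (\<lambda>w. ennreal (g w))) {w. a < w $ 1}"
      unfolding M_def by (subst emeasure_distr) (auto simp: vimage_def)
    also have "\<dots> = (\<integral>\<^sup>+w. ennreal (g w) * indicator {w. a < w $ 1} w \<partial>lborel)"
      by (subst emeasure_density) auto
    also have "\<dots> = (\<integral>\<^sup>+w. ennreal (g w * indicator {w. a < w $ 1} w) \<partial>lborel)"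
      by (intro nn_integral_cong) (auto simp: indicator_def)
    also have "\<dots> = ennreal (\<integral>w. g w * indicator {w. a < w $ 1} w \<partial>lborel)"
      using g by (intro nn_integral_eq_integral ind) auto
    finally show ?thesis .
  qed
  have eq: "(\<integral>w. p w * indicator {w. a < w $ 1} w \<partial>lborel) = (\<integral>w. n w * indicator {w. a < w $ 1} w \<partial>lborel)" for a
    using z[of a] Bochner_Integration.integral_diff[OF ind[OF ip] ind[OF in_], of a a]
    by (simp add: pn(3) left_diff_distrib)
  have MM: "M p = M n"
  proof (rule measure_eqI_lessThan)
    show "emeasure (M p) {a<..} = emeasure (M n) {a<..}" "emeasure (M p) {a<..} < \<infinity>" for a
      using em[OF ip pn(1)] em[OF in_ pn(2)] eq by auto
  qed (auto simp: M_def)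
  have Mh: "integral\<^sup>L (M g) h = (\<integral>w. g w *\<^sub>R h (w $ 1) \<partial>lborel)"
    if [measurable]: "g \<in> borel_measurable borel" and "\<And>w. 0 \<le> g w" for g
    using that unfolding M_def by (simp add: integral_distr integral_density)
  have "(\<integral>w. p w *\<^sub>R h (w $ 1) \<partial>lborel) = (\<integral>w. n w *\<^sub>R h (w $ 1) \<partial>lborel)"
    using Mh[of p, OF _ pn(1)] Mh[of n, OF _ pn(2)] MM by simp
  moreover have "integrable lborel (\<lambda>w. g w *\<^sub>R h (w $ 1))" if g: "integrable lborel g" for g :: "real^2 \<Rightarrow> real"
  proof -
    have [measurable]: "g \<in> borel_measurable borel" using g by auto
    show ?thesis
      by (rule Bochner_Integration.integrable_bound[OF g]) (auto intro!: mult_left_le h1)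
  qed
  ultimately show ?thesis
    using ip in_ by (simp add: pn(3) scaleR_left_diff_distrib)
qed

text \<open>If all half-plane integrals vanished, then so would the integral of \<open>\<phi>\<close> against every bounded function of the
first coordinate, in particular against the exponential.\<close>

lemma exists_nonzero_halfspace_integral:
  fixes \<phi> :: "real^2 \<Rightarrow> complex"
  assumes \<phi>: "integrable lborel \<phi>" and nz: "(\<integral>w. \<phi> w * exp (- \<i> * of_real (w $ 1)) \<partial>lborel) \<noteq> 0"
  obtains a where "(\<integral>w. \<phi> w * indicator {w. a < w $ 1} w \<partial>lborel) \<noteq> 0"
proof (rule ccontr)
  assume "\<not> thesis"
  with that have zero: "(\<integral>w. \<phi> w * indicator {w. a < w $ 1} w \<partial>lborel) = 0" for a by blast
  have [measurable]: "(\<lambda>w::real^2. w $ 1) \<in> borel_measurable borel"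
    by (intro borel_measurable_continuous_onI continuous_intros)
  have [measurable]: "\<phi> \<in> borel_measurable borel" using \<phi> by auto
  let ?h = "\<lambda>x::real. exp (- \<i> * of_real x)"
  have hm [measurable]: "?h \<in> borel_measurable borel"
    by (intro borel_measurable_continuous_onI continuous_intros)
  have h1: "norm (?h x) \<le> 1" for x by simp
  have i: "integrable lborel (\<lambda>w. \<phi> w * indicator {w. a < w $ 1} w)" for a
    by (rule Bochner_Integration.integrable_bound[OF \<phi>]) (auto simp: indicator_def)
  have ih: "integrable lborel (\<lambda>w. \<phi> w * ?h (w $ 1))"
    by (rule Bochner_Integration.integrable_bound[OF \<phi>]) (auto simp: norm_mult)
  have "(\<integral>w. Re (\<phi> w) * indicator {w. a < w $ 1} w \<partial>lborel) = Re (\<integral>w. \<phi> w * indicator {w. a < w $ 1} w \<partial>lborel)" for a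
    using i by (subst integral_Re [symmetric]) (auto intro!: Bochner_Integration.integral_cong simp: indicator_def)
  then have re: "(\<integral>w. Re (\<phi> w) *\<^sub>R ?h (w $ 1) \<partial>lborel) = 0"
    using \<phi> zero by (intro halfspace_integrals_determine hm h1) auto
  have "(\<integral>w. Im (\<phi> w) * indicator {w. a < w $ 1} w \<partial>lborel) = Im (\<integral>w. \<phi> w * indicator {w. a < w $ 1} w \<partial>lborel)" for a
    using i by (subst integral_Im [symmetric]) (auto intro!: Bochner_Integration.integral_cong simp: indicator_def)
  then have im: "(\<integral>w. Im (\<phi> w) *\<^sub>R ?h (w $ 1) \<partial>lborel) = 0"
    using \<phi> zero by (intro halfspace_integrals_determine hm h1) auto
  have ire: "integrable lborel (\<lambda>w. Re (\<phi> w) *\<^sub>R ?h (w $ 1))" and iim: "integrable lborel (\<lambda>w. Im (\<phi> w) *\<^sub>R ?h (w $ 1))"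
    by (rule Bochner_Integration.integrable_bound[OF \<phi>]; auto simp: abs_Re_le_cmod abs_Im_le_cmod)+
  have "(\<integral>w. \<phi> w * ?h (w $ 1) \<partial>lborel) = (\<integral>w. Re (\<phi> w) *\<^sub>R ?h (w $ 1) + \<i> * (Im (\<phi> w) *\<^sub>R ?h (w $ 1)) \<partial>lborel)"
    by (intro Bochner_Integration.integral_cong refl)
       (metis (no_types, lifting) complex_eq distrib_right mult.assoc scaleR_conv_of_real)
  also have "\<dots> = 0"
    by (simp only: Bochner_Integration.integral_add[OF ire integrable_mult_right[OF iim]] integral_mult_right_zero re im) simp
  finally show False using nz by simp
qed

text \<open>The blow-up gives convergence to the half-plane integral \<open>c a\<close> along every sequence of points of the outer edge with
angle tending to infinity and direction tending to that of the first axis; by contradiction, the limit yields a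
bound which is uniform in a neighbourhood. The uniformity in the direction is what is needed later: a single ray
would meet too few points.\<close>

lemma spiral_conv_lower_bound:
  fixes \<phi> :: "real^2 \<Rightarrow> complex"
  defines "c \<equiv> \<lambda>a. \<integral>w. \<phi> w * indicator {w. a < w $ 1} w \<partial>lborel"
  assumes \<phi>: "integrable lborel \<phi>" and nz: "c a \<noteq> 0"
  obtains \<eta> N where "0 < \<eta>"
    "\<And>t \<delta> z. N \<le> t \<Longrightarrow> 0 < \<delta> \<Longrightarrow> \<delta> \<le> 16 * (spiral_radius t)\<^sup>2 \<Longrightarrow> \<bar>cos t - 1\<bar> \<le> \<eta> \<Longrightarrow> \<bar>sin t\<bar> \<le> \<eta> \<Longrightarrow>
      norm (z - vector [a, 0]) \<le> \<eta> \<Longrightarrow> norm (c a) / 2 \<le> norm (spiral_conv \<phi> \<delta> (polar (spiral_radius t) t + \<delta> *\<^sub>R z))"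
proof (rule ccontr)
  let ?g = spiral_radius
  assume neg: "\<not> thesis"
  \<comment> \<open>A violation of the claim for the neighbourhood of size \<open>1 / (n + 1)\<close> and angles beyond \<open>n\<close>.\<close>
  define bad where "bad n t \<delta> z \<longleftrightarrow> real n \<le> t \<and> 0 < \<delta> \<and> \<delta> \<le> 16 * (?g t)\<^sup>2 \<and>
      \<bar>cos t - 1\<bar> \<le> inverse (real (Suc n)) \<and> \<bar>sin t\<bar> \<le> inverse (real (Suc n)) \<and>
      norm (z - vector [a, 0]) \<le> inverse (real (Suc n)) \<and>
      norm (spiral_conv \<phi> \<delta> (polar (?g t) t + \<delta> *\<^sub>R z)) < norm (c a) / 2" for n t \<delta> z
  have "\<exists>t \<delta> z. bad n t \<delta> z" for n
  proof (rule ccontr)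
    assume *: "\<nexists>t \<delta> z. bad n t \<delta> z"
    have thesis
    proof (rule that[of "inverse (real (Suc n))" "real n"])
      fix t \<delta> and z :: "real^2"
      assume "real n \<le> t" "0 < \<delta>" "\<delta> \<le> 16 * (?g t)\<^sup>2" "\<bar>cos t - 1\<bar> \<le> inverse (real (Suc n))"
        "\<bar>sin t\<bar> \<le> inverse (real (Suc n))" "norm (z - vector [a, 0]) \<le> inverse (real (Suc n))"
      moreover have "\<not> bad n t \<delta> z" using * by blast
      ultimately show "norm (c a) / 2 \<le> norm (spiral_conv \<phi> \<delta> (polar (?g t) t + \<delta> *\<^sub>R z))"
        unfolding bad_def by linarith
    qed simp
    then show False using neg by contradiction
  qed
  then obtain t where "\<And>n. \<exists>\<delta> z. bad n (t n) \<delta> z" by metis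
  then obtain \<delta> where "\<And>n. \<exists>z. bad n (t n) (\<delta> n) z" by metis
  then obtain z where bad: "\<And>n. bad n (t n) (\<delta> n) (z n)" by metis
  have t: "real n \<le> t n" and \<delta>: "0 < \<delta> n" "\<delta> n \<le> 16 * (?g (t n))\<^sup>2"
    and cs: "\<bar>cos (t n) - 1\<bar> \<le> inverse (real (Suc n))" "\<bar>sin (t n)\<bar> \<le> inverse (real (Suc n))"
    and z: "norm (z n - vector [a, 0]) \<le> inverse (real (Suc n))"
    and small: "norm (spiral_conv \<phi> (\<delta> n) (polar (?g (t n)) (t n) + \<delta> n *\<^sub>R z n)) < norm (c a) / 2" for n
    using bad[of n] unfolding bad_def by blast+
  have lim0: "(\<lambda>n. inverse (real (Suc n))) \<longlonglongrightarrow> 0" by (rule LIMSEQ_inverse_real_of_nat)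
  have cos1: "(\<lambda>n. cos (t n)) \<longlonglongrightarrow> 1"
    by (rule LIM_zero_cancel, rule Lim_null_comparison[OF always_eventually lim0]) (simp only: real_norm_def cs simp_thms)
  have sin0: "(\<lambda>n. sin (t n)) \<longlonglongrightarrow> 0"
    by (rule Lim_null_comparison[OF always_eventually lim0]) (simp only: real_norm_def cs simp_thms)
  have zlim: "z \<longlonglongrightarrow> vector [a, 0]"
    by (rule LIM_zero_cancel, rule Lim_null_comparison[OF always_eventually lim0]) (simp only: z simp_thms)
  have ttop: "filterlim t at_top sequentially"
    by (rule filterlim_at_top_mono[OF filterlim_real_sequentially]) (use t in auto)
  have [measurable]: "\<phi> \<in> borel_measurable borel" using \<phi> by auto
  have [measurable]: "(\<lambda>w::real^2. w $ 1) \<in> borel_measurable borel"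
    by (intro borel_measurable_continuous_onI continuous_intros)
  have pointwise: "(\<lambda>n. indicator spiral (polar (?g (t n)) (t n) + \<delta> n *\<^sub>R z n - \<delta> n *\<^sub>R w) :: complex) \<longlonglongrightarrow> indicator {w. a < w $ 1} w"
    if w: "w $ 1 \<noteq> a" for w
  proof -
    define v where "v n = z n - w" for n
    \<comment> \<open>Radial and tangential coordinates of \<open>v n\<close> at the angle \<open>t n\<close>.\<close>
    define A where "A n = cos (t n) * v n $ 1 + sin (t n) * v n $ 2" for n
    define Q where "Q n = cos (t n) * v n $ 2 - sin (t n) * v n $ 1" for n
    have v1: "(\<lambda>n. v n $ 1) \<longlonglongrightarrow> a - w $ 1" "(\<lambda>n. v n $ 2) \<longlonglongrightarrow> 0 - w $ 2"
      using tendsto_diff[OF tendsto_vec_nth[OF zlim, of 1] tendsto_const[of "w $ 1"]]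
        tendsto_diff[OF tendsto_vec_nth[OF zlim, of 2] tendsto_const[of "w $ 2"]]
      by (simp_all add: v_def)
    have A: "A \<longlonglongrightarrow> a - w $ 1"
      unfolding A_def using tendsto_add[OF tendsto_mult[OF cos1 v1(1)] tendsto_mult[OF sin0 v1(2)]] by simp
    have Q: "Q \<longlonglongrightarrow> - (w $ 2)"
      unfolding Q_def using tendsto_diff[OF tendsto_mult[OF cos1 v1(2)] tendsto_mult[OF sin0 v1(1)]] by simp
    define \<epsilon> where "\<epsilon> = \<bar>a - w $ 1\<bar> / 2"
    define B where "B = \<bar>a - w $ 1\<bar> + \<bar>w $ 2\<bar> + 1"
    have \<epsilon>: "0 < \<epsilon>" using w by (simp add: \<epsilon>_def)
    have "0 < B" by (simp add: B_def add_nonneg_pos)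
    have sgn: "\<forall>\<^sub>F n in sequentially. A n < 0 \<longleftrightarrow> a < w $ 1"
    proof (cases "a < w $ 1")
      case True
      then have "\<forall>\<^sub>F n in sequentially. A n < 0" using order_tendstoD(2)[OF A, of 0] by simp
      then show ?thesis by eventually_elim (use True in simp)
    next
      case False
      then have "\<forall>\<^sub>F n in sequentially. A n > 0" using order_tendstoD(1)[OF A, of 0] w by simp
      then show ?thesis by eventually_elim (use False in simp)
    qed
    have eA1: "\<forall>\<^sub>F n in sequentially. \<epsilon> < \<bar>A n\<bar>"
      by (rule order_tendstoD(1)[OF tendsto_rabs[OF A]]) (use w in \<open>simp add: \<epsilon>_def\<close>)
    have eA2: "\<forall>\<^sub>F n in sequentially. \<bar>A n\<bar> < B"
      by (rule order_tendstoD(2)[OF tendsto_rabs[OF A]]) (simp add: B_def)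
    have eQ: "\<forall>\<^sub>F n in sequentially. \<bar>Q n\<bar> < B"
      by (rule order_tendstoD(2)[OF tendsto_rabs[OF Q]]) (simp add: B_def)
    have rot: "polar (A n) (t n) + polar (Q n) (t n + pi / 2) = v n" for n
    proof -
      have cs1: "cos (t n) * (cos (t n) * x) + sin (t n) * (sin (t n) * x) = x" for x
      proof -
        have "cos (t n) * (cos (t n) * x) + sin (t n) * (sin (t n) * x) = ((cos (t n))\<^sup>2 + (sin (t n))\<^sup>2) * x"
          by (simp only: power2_eq_square distrib_right mult.assoc)
        then show ?thesis by simp
      qed
      show ?thesis
        using cs1[of "v n $ 1"] cs1[of "v n $ 2"]
        by (intro vec2_eqI) (simp_all add: A_def Q_def cos_add sin_add algebra_simps)
    qed
    note ev = eventually_compose_filterlim[OF spiral_blowup[OF \<epsilon> \<open>0 < B\<close>] ttop]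
    have "\<forall>\<^sub>F n in sequentially. (indicator spiral (polar (?g (t n)) (t n) + \<delta> n *\<^sub>R z n - \<delta> n *\<^sub>R w) :: complex) = indicator {w. a < w $ 1} w"
      using ev sgn eA1 eA2 eQ
    proof eventually_elim
      fix n
      assume blow: "\<forall>\<delta> a q. 0 < \<delta> \<and> \<delta> \<le> 16 * (?g (t n))\<^sup>2 \<and> \<epsilon> \<le> \<bar>a\<bar> \<and> \<bar>a\<bar> \<le> B \<and> \<bar>q\<bar> \<le> B \<longrightarrow>
        (polar (?g (t n)) (t n) + \<delta> *\<^sub>R (polar a (t n) + polar q (t n + pi / 2)) \<in> spiral \<longleftrightarrow> a < 0)"
        and *: "(A n < 0) = ( a < w $ 1)" "\<epsilon> < \<bar>A n\<bar>" "\<bar>A n\<bar> < B" "\<bar>Q n\<bar> < B"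
      have "polar (?g (t n)) (t n) + \<delta> n *\<^sub>R (polar (A n) (t n) + polar (Q n) (t n + pi / 2)) \<in> spiral \<longleftrightarrow> A n < 0"
        using \<delta>[of n] * by (intro blow[rule_format]) auto
      moreover have "polar (?g (t n)) (t n) + \<delta> n *\<^sub>R v n = polar (?g (t n)) (t n) + \<delta> n *\<^sub>R z n - \<delta> n *\<^sub>R w"
        by (simp add: v_def algebra_simps)
      ultimately have "polar (?g (t n)) (t n) + \<delta> n *\<^sub>R z n - \<delta> n *\<^sub>R w \<in> spiral \<longleftrightarrow> a < w $ 1"
        using * unfolding rot by simp
      then show "(indicator spiral (polar (?g (t n)) (t n) + \<delta> n *\<^sub>R z n - \<delta> n *\<^sub>R w) :: complex) = indicator {w. a < w $ 1} w"
        by (simp add: indicator_def)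
    qed
    then show ?thesis by (rule tendsto_eventually)
  qed
  have null: "AE w::real^2 in lborel. w $ 1 \<noteq> a"
  proof -
    have "negligible {w::real^2. w $ 1 = a}"
      using negligible_standard_hyperplane[of "axis 1 1 :: real^2" a]
      by (simp add: inner_axis cart_eq_inner_axis [symmetric] axis_in_Basis_iff)
    then have "{w::real^2. w $ 1 = a} \<in> null_sets lborel"
      by (simp add: negligible_iff_null_sets null_sets_completion_iff)
    then show ?thesis by (rule AE_I') auto
  qed
  have "(\<lambda>n. spiral_conv \<phi> (\<delta> n) (polar (?g (t n)) (t n) + \<delta> n *\<^sub>R z n)) \<longlonglongrightarrow> c a"
    unfolding spiral_conv_def c_def
  proof (rule integral_dominated_convergence[where w = "\<lambda>w. norm (\<phi> w)"])
    show "AE w in lborel. (\<lambda>n. \<phi> w * indicator spiral (polar (?g (t n)) (t n) + \<delta> n *\<^sub>R z n - \<delta> n *\<^sub>R w)) \<longlonglongrightarrow> \<phi> w * indicator {w. a < w $ 1} w"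
      using null by eventually_elim (intro tendsto_mult tendsto_const pointwise)
    show "AE w in lborel. norm (\<phi> w * indicator spiral (polar (?g (t n)) (t n) + \<delta> n *\<^sub>R z n - \<delta> n *\<^sub>R w)) \<le> norm (\<phi> w)" for n
      by (auto simp: indicator_def)
    show "integrable lborel (\<lambda>w. norm (\<phi> w))" using \<phi> by (rule integrable_norm)
    show "(\<lambda>w. \<phi> w * indicator {w. a < w $ 1} w) \<in> borel_measurable lborel"
      "(\<lambda>w. \<phi> w * indicator spiral (polar (?g (t n)) (t n) + \<delta> n *\<^sub>R z n - \<delta> n *\<^sub>R w)) \<in> borel_measurable lborel" for n
      by measurable
  qed
  from order_tendstoD(1)[OF tendsto_norm[OF this], of "norm (c a) / 2"] nz
  have "\<forall>\<^sub>F n in sequentially. norm (c a) / 2 < norm (spiral_conv \<phi> (\<delta> n) (polar (?g (t n)) (t n) + \<delta> n *\<^sub>R z n))" by simp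
  then obtain n where "norm (c a) / 2 < norm (spiral_conv \<phi> (\<delta> n) (polar (?g (t n)) (t n) + \<delta> n *\<^sub>R z n))"
    by (auto simp: eventually_sequentially)
  with small[of n] show False by simp
qed

section \<open>Many points where the averages are large\<close>

text \<open>Integrate the indicator of the pairs \<open>(x, y)\<close> in \<open>S \<times> A\<close> at distance at most \<open>R\<close> in both orders.\<close>

lemma emeasure_density_points:
  fixes S A :: "(real^2) set"
  assumes [measurable]: "S \<in> sets borel" "A \<in> sets borel" and R: "0 \<le> R"
    and dens: "\<And>x. x \<in> S \<Longrightarrow> v \<le> emeasure lborel (A \<inter> cball x R)"
  shows "v * emeasure lborel S \<le> ennreal (pi * R\<^sup>2) * emeasure lborel A"
proof -
  define D :: "(real^2) set" where "D = cball 0 R"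
  have [measurable]: "D \<in> sets borel" by (simp add: D_def)
  have ball: "indicator D (y - x) = (indicator (cball x R) y :: ennreal)"
    "indicator D (y - x) = (indicator (cball y R) x :: ennreal)" for x y :: "real^2"
    by (auto simp: D_def indicator_def dist_norm norm_minus_commute)
  have "v * emeasure lborel S = (\<integral>\<^sup>+x. v * indicator S x \<partial>lborel)"
    by (subst nn_integral_cmult_indicator) auto
  also have "\<dots> \<le> (\<integral>\<^sup>+x. \<integral>\<^sup>+y. indicator A y * indicator D (y - x) \<partial>lborel \<partial>lborel)"
  proof (rule nn_integral_mono)
    fix x :: "real^2"
    have "(\<integral>\<^sup>+y. indicator A y * indicator D (y - x) \<partial>lborel) = (\<integral>\<^sup>+y. indicator (A \<inter> cball x R) y \<partial>lborel)"
      unfolding ball(1) by (intro nn_integral_cong) (auto simp: indicator_def)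
    also have "\<dots> = emeasure lborel (A \<inter> cball x R)" by (intro nn_integral_indicator) auto
    finally show "v * indicator S x \<le> (\<integral>\<^sup>+y. indicator A y * indicator D (y - x) \<partial>lborel)"
      using dens[of x] by (auto simp: indicator_def)
  qed
  also have "\<dots> = (\<integral>\<^sup>+y. \<integral>\<^sup>+x. indicator A y * indicator D (y - x) \<partial>lborel \<partial>lborel)"
    by (rule lborel_pair.Fubini') measurable
  also have "\<dots> = (\<integral>\<^sup>+y. ennreal (pi * R\<^sup>2) * indicator A y \<partial>lborel)"
    unfolding ball(2) using R
    by (intro nn_integral_cong, subst nn_integral_cmult)
       (auto intro!: borel_measurable_indicator simp: emeasure_cball unit_ball_vol_2 mult.commute)
  also have "\<dots> = ennreal (pi * R\<^sup>2) * emeasure lborel A"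
    by (subst nn_integral_cmult_indicator) auto
  finally show ?thesis .
qed

text \<open>Moving outwards along the ray through \<open>x\<close> one meets the outer edge within less than one spacing of the turns, which is
about \<open>g t / t = (g t)\<^sup>2 (log t)\<^sup>2\<close>; moreover \<open>g t\<close> is comparable to the norm of \<open>x\<close>, and \<open>t\<close> is at most
\<open>1 / g t\<close>.\<close>

lemma nearby_arm_point:
  obtains r0 where "0 < r0"
    "\<And>x. x \<noteq> 0 \<Longrightarrow> norm x < r0 \<Longrightarrow> \<exists>t\<ge>T. cos t = cos (angle x) \<and> sin t = sin (angle x) \<and>
       norm x \<le> spiral_radius t \<and> dist x (polar (spiral_radius t) t) \<le> 96 * ((norm x)\<^sup>2 * (log 2 (1 / norm x))\<^sup>2)"
proof -
  let ?g = spiral_radius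
  have "((\<lambda>t. ?g (t + 2 * pi) / ?g t) \<longlongrightarrow> 1) at_top"
    unfolding spiral_radius_def by real_asymp
  from order_tendstoD(1)[OF this, of "1/2"]
  obtain T1 where T1: "\<And>t. T1 \<le> t \<Longrightarrow> 1/2 < ?g (t + 2 * pi) / ?g t"
    by (auto simp: eventually_at_top_linorder)
  define T2 where "T2 = max T (max T1 20)"
  have T2: "T \<le> T2" "T1 \<le> T2" "20 \<le> T2" by (auto simp: T2_def)
  define r0 where "r0 = ?g (T2 + 2 * pi)"
  show ?thesis
  proof (rule that)
    show "0 < r0" unfolding r0_def using T2 pi_bounds by (intro spiral_radius_pos) auto
    fix x :: "real^2" assume x: "x \<noteq> 0" "norm x < r0"
    define \<alpha> where "\<alpha> = angle x"
    have \<alpha>: "0 \<le> \<alpha>" "\<alpha> < 2 * pi" using angle_bounds by (auto simp: \<alpha>_def)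
    have "r0 \<le> ?g (\<alpha> + 2 * pi)" unfolding r0_def using T2 \<alpha> pi_bounds by (intro spiral_radius_antimono) auto
    then have xr: "0 < norm x" "norm x < ?g (\<alpha> + 2 * pi)" using x by auto
    have "1 < \<alpha> + 2 * pi" using \<alpha> pi_bounds by linarith
    then obtain n where n: "?g (\<alpha> + 2 * pi + 2 * pi * (real n + 1)) \<le> norm x" "norm x < ?g (\<alpha> + 2 * pi + 2 * pi * real n)"
      using spiral_radius_bracket[of "\<alpha> + 2 * pi" "2 * pi" "norm x"] xr by auto
    define t where "t = \<alpha> + 2 * pi + 2 * pi * real n"
    have t2: "\<alpha> + 2 * pi + 2 * pi * (real n + 1) = t + 2 * pi" by (simp add: t_def algebra_simps)
    have t: "?g (t + 2 * pi) \<le> norm x" "norm x < ?g t" using n unfolding t2 by (simp_all add: t_def)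
    have "2 * pi \<le> t" using \<alpha> by (simp add: t_def)
    then have t1: "1 < t" "1 < t + 2 * pi" using pi_bounds by linarith+
    have "?g (t + 2 * pi) < ?g (T2 + 2 * pi)" using t x by (simp add: r0_def)
    moreover have "1 < T2 + 2 * pi" using T2 pi_bounds by linarith
    ultimately have "T2 + 2 * pi < t + 2 * pi" using t1(2) by (metis spiral_radius_less_imp_less)
    then have tT: "T2 < t" by simp
    have g: "0 < ?g t" using t1 by (simp add: spiral_radius_pos)
    have "1/2 < ?g (t + 2 * pi) / ?g t" using tT T2 by (intro T1) auto
    then have half: "?g t \<le> 2 * norm x" using t g by (simp add: field_simps)
    have "sin t = sin \<alpha> \<and> cos t = cos \<alpha>"
      unfolding sin_cos_eq_iff by (intro exI[of _ "int n + 1"]) (simp add: t_def algebra_simps)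
    then have trig: "cos t = cos \<alpha>" "sin t = sin \<alpha>" by auto
    have l: "1 \<le> log 2 t" using tT T2 by (simp add: le_log_iff)
    have "log 2 t \<noteq> 0" using l by linarith
    then have inv: "1 / t = ?g t * (log 2 t)\<^sup>2" by (simp add: spiral_radius_def)
    have "?g t \<le> 1 / t"
      unfolding inv using mult_left_mono[of 1 "(log 2 t)\<^sup>2" "?g t"] g l by simp
    then have "?g t * t \<le> 1" using t1 by (simp add: field_simps)
    moreover have "norm x * t \<le> ?g t * t" using t t1 by (intro mult_right_mono) auto
    ultimately have "t \<le> 1 / norm x" using xr by (simp add: field_simps)
    then have logt: "log 2 t \<le> log 2 (1 / norm x)" using t1 by (intro log_mono) auto
    have "x = polar (norm x) t"
      using polar_angle[of x] trig unfolding polar_def \<alpha>_def by simp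
    then have "dist x (polar (?g t) t) = dist (polar (norm x) t) (polar (?g t) t)" by simp
    also have "\<dots> = norm (polar (norm x - ?g t) t)"
      unfolding dist_norm by (intro arg_cong[of _ _ norm] vec2_eqI) (simp_all add: algebra_simps)
    also have "\<dots> = ?g t - norm x" using t by simp
    also have "\<dots> \<le> \<bar>?g t - ?g (t + 2 * pi)\<bar>" using t by simp
    also have "\<dots> \<le> 3 * (?g t / t) * \<bar>t - (t + 2 * pi)\<bar>"
      using tT T2 by (intro spiral_radius_Lipschitz) auto
    also have "\<dots> \<le> 3 * (?g t / t) * 8" using pi_bounds g t1 by (intro mult_left_mono) auto
    also have "\<dots> = 24 * ((?g t)\<^sup>2 * (log 2 t)\<^sup>2)"
      using inv by (simp add: power2_eq_square mult_ac divide_inverse)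
    also have "\<dots> \<le> 24 * ((2 * norm x)\<^sup>2 * (log 2 (1 / norm x))\<^sup>2)"
      using half g logt l by (intro mult_left_mono mult_mono power_mono) auto
    finally have d: "dist x (polar (?g t) t) \<le> 96 * ((norm x)\<^sup>2 * (log 2 (1 / norm x))\<^sup>2)"
      by (simp add: power_mult_distrib)
    show "\<exists>t\<ge>T. cos t = cos (angle x) \<and> sin t = sin (angle x) \<and>
       norm x \<le> ?g t \<and> dist x (polar (?g t) t) \<le> 96 * ((norm x)\<^sup>2 * (log 2 (1 / norm x))\<^sup>2)"
      using tT T2 trig t d by (intro exI[of _ t]) (auto simp: \<alpha>_def)
  qed
qed

text \<open>Let \<open>l = 2\<^sup>-\<^sup>m\<close> and \<open>\<delta> = l\<^sup>2\<close>. Every point of a box \<open>S\<close> of area comparable to \<open>l\<^sup>2\<close>, chosen so flat that its points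
are seen from the origin in almost horizontal directions, has within the distance \<open>R\<close> of order \<open>\<delta> m\<^sup>2\<close> a
disc of radius comparable to \<open>\<delta>\<close> on which the function is large. Averaging over \<open>S\<close> loses the factor
\<open>(\<delta> / R)\<^sup>2\<close>, that is, \<open>1 / m\<^sup>4\<close>. This loss is harmless in the end, as the critical inequality is strict.\<close>

lemma spiral_conv_large_set:
  fixes \<phi> :: "real^2 \<Rightarrow> complex"
  assumes \<phi>: "integrable lborel \<phi>" and nz: "(\<integral>w. \<phi> w * indicator {w. a < w $ 1} w \<partial>lborel) \<noteq> 0"
  obtains c K where "0 < c" "0 < K"
    "\<forall>\<^sub>F m in sequentially. \<exists>A \<in> sets borel. A \<subseteq> dyadic_cube (int m) 0 \<and>
       (\<forall>x\<in>A. c \<le> norm (spiral_conv \<phi> ((1/2) ^ (2 * m)) x)) \<and>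
       ennreal (K * (1/2) ^ (2 * m) / (real m + 2) ^ 4) \<le> emeasure lborel A"
proof -
  let ?g = spiral_radius
  define c where "c = norm (\<integral>w. \<phi> w * indicator {w. a < w $ 1} w \<partial>lborel) / 2"
  define z0 :: "real^2" where "z0 = vector [a, 0]"
  have c: "0 < c" using nz by (simp add: c_def)
  obtain \<eta> N where \<eta>: "0 < \<eta>" and low: "\<And>t \<delta> z. N \<le> t \<Longrightarrow> 0 < \<delta> \<Longrightarrow> \<delta> \<le> 16 * (?g t)\<^sup>2 \<Longrightarrow> \<bar>cos t - 1\<bar> \<le> \<eta> \<Longrightarrow> \<bar>sin t\<bar> \<le> \<eta> \<Longrightarrow>
      norm (z - z0) \<le> \<eta> \<Longrightarrow> c \<le> norm (spiral_conv \<phi> \<delta> (polar (?g t) t + \<delta> *\<^sub>R z))"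
    unfolding c_def z0_def by (rule spiral_conv_lower_bound[OF \<phi> nz]) blast
  obtain r0 where r0: "0 < r0" and arm: "\<And>x. x \<noteq> 0 \<Longrightarrow> norm x < r0 \<Longrightarrow> \<exists>t\<ge>N. cos t = cos (angle x) \<and> sin t = sin (angle x) \<and>
       norm x \<le> ?g t \<and> dist x (polar (?g t) t) \<le> 96 * ((norm x)\<^sup>2 * (log 2 (1 / norm x))\<^sup>2)"
    using nearby_arm_point[of N] by metis
  \<comment> \<open>On the box the sine of the angle is at most \<open>2 \<kappa> l / (l / 4) = 8 \<kappa>\<close>, which is at most \<open>\<eta> / 2\<close>.\<close>
  define \<kappa> where "\<kappa> = min 1 \<eta> / 16"
  have \<kappa>: "0 < \<kappa>" "\<kappa> \<le> 1/16" "16 * \<kappa> \<le> \<eta>" using \<eta> by (auto simp: \<kappa>_def)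
  define C where "C = 96 + norm z0 + \<eta>"
  have C: "0 < C" using \<eta> by (simp add: C_def add_pos_nonneg add_nonneg_pos)
  define K where "K = \<kappa> * \<eta>\<^sup>2 / (4 * C\<^sup>2)"
  have [measurable]: "\<phi> \<in> borel_measurable borel" using \<phi> by auto
  have "(\<lambda>m. (1/2) ^ m * (real m + 2)\<^sup>2) \<longlonglongrightarrow> 0" by real_asymp
  from order_tendstoD(2)[OF tendsto_mult_right_zero[OF this, of C], of "\<kappa> / 2"] \<kappa>
  have ev1: "\<forall>\<^sub>F m in sequentially. C * ((1/2) ^ m * (real m + 2)\<^sup>2) < \<kappa> / 2" by simp
  have "(\<lambda>m. (1/2 :: real) ^ m) \<longlonglongrightarrow> 0" by real_asymp
  from order_tendstoD(2)[OF this r0]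
  have ev2: "\<forall>\<^sub>F m in sequentially. (1/2) ^ m < r0" .
  have "\<forall>\<^sub>F m in sequentially. \<exists>A \<in> sets borel. A \<subseteq> dyadic_cube (int m) 0 \<and>
       (\<forall>x\<in>A. c \<le> norm (spiral_conv \<phi> ((1/2) ^ (2 * m)) x)) \<and>
       ennreal (K * (1/2) ^ (2 * m) / (real m + 2) ^ 4) \<le> emeasure lborel A"
    using ev1 ev2
  proof eventually_elim
    fix m :: nat
    define l :: real where "l = (1/2) ^ m"
    assume e1: "C * ((1/2) ^ m * (real m + 2)\<^sup>2) < \<kappa> / 2" and e2: "(1/2) ^ m < r0"
    have l: "0 < l" "l < r0" using e2 by (auto simp: l_def)
    define \<delta> where "\<delta> = l\<^sup>2"
    have \<delta>: "0 < \<delta>" "(1/2) ^ (2 * m) = \<delta>" using l by (auto simp: \<delta>_def l_def power_mult mult.commute[of 2])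
    define R where "R = C * (real m + 2)\<^sup>2 * \<delta>"
    have R0: "0 < R" using C \<delta> by (simp add: R_def add_nonneg_pos)
    have "R = l * (C * (l * (real m + 2)\<^sup>2))" by (simp add: R_def \<delta>_def power2_eq_square)
    also have "\<dots> \<le> l * (\<kappa> / 2)" using l e1 by (intro mult_left_mono) (auto simp: l_def)
    finally have R: "R \<le> \<kappa> * l / 2" by (simp add: mult.commute)
    have kl: "0 < \<kappa> * l" "\<kappa> * l \<le> l / 16" using \<kappa> l mult_right_mono[of \<kappa> "1/16" l] by auto
    define cube where "cube = {x::real^2. 0 < x $ 1 \<and> x $ 1 < l \<and> 0 < x $ 2 \<and> x $ 2 < l}"
    have cube_sub: "cube \<subseteq> dyadic_cube (int m) 0"
      unfolding cube_def dyadic_cube_def l_def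
      by (auto simp: forall_2 power_int_minus power_one_over inverse_eq_divide)
    have [measurable]: "cube \<in> sets borel"
      unfolding cube_def
      by (intro borel_open open_Collect_conj open_Collect_less continuous_intros)
    define A where "A = {x. c \<le> norm (spiral_conv \<phi> \<delta> x)} \<inter> cube"
    have A [measurable]: "A \<in> sets borel" unfolding A_def by measurable
    define S where "S = cbox (vector [l / 4, \<kappa> * l] :: real^2) (vector [l / 2, 2 * \<kappa> * l])"
    have S [measurable]: "S \<in> sets borel" by (simp add: S_def)
    have mS: "emeasure lborel S = ennreal (l / 4 * (\<kappa> * l))"
    proof -
      have ne: "S \<noteq> {}" unfolding S_def using l kl by (auto simp: interval_ne_empty_cart forall_2)
      have mS': "measure lborel S = l / 4 * (\<kappa> * l)"
        using content_cbox_cart[OF ne[unfolded S_def]] unfolding S_def by (simp add: UNIV_2 field_simps)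
      have "emeasure lborel S < \<infinity>" unfolding S_def by (rule emeasure_lborel_cbox_finite)
      then have "emeasure lborel S \<noteq> top" by simp
      from emeasure_eq_ennreal_measure[OF this] show ?thesis unfolding mS' .
    qed
    have dens: "ennreal (pi * (\<delta> * \<eta>)\<^sup>2) \<le> emeasure lborel (A \<inter> cball x R)" if x: "x \<in> S" for x
    proof -
      have xb: "l / 4 \<le> x $ 1" "x $ 1 \<le> l / 2" "\<kappa> * l \<le> x $ 2" "x $ 2 \<le> 2 * (\<kappa> * l)"
        using x by (auto simp: S_def mem_box_cart forall_2 mult.assoc)
      have nx1: "l / 4 \<le> norm x" using component_le_norm_cart[of x 1] xb by linarith
      have nx2: "norm x \<le> l" using norm_vec2_le[of x] xb kl l by linarith
      have nx0: "0 < norm x" using nx1 l by linarith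
      obtain t where t: "N \<le> t" "cos t = cos (angle x)" "sin t = sin (angle x)" "norm x \<le> ?g t"
        and dist_t: "dist x (polar (?g t) t) \<le> 96 * ((norm x)\<^sup>2 * (log 2 (1 / norm x))\<^sup>2)"
        using arm[of x] nx0 nx2 l by auto
      have x12: "x $ 1 = norm x * cos t" "x $ 2 = norm x * sin t"
        using polar_nth[of "norm x" "angle x"] unfolding polar_angle t(2,3) by auto
      have "0 < norm x * cos t" using x12(1) xb l by linarith
      then have ct: "0 < cos t" "cos t \<le> 1" using zero_less_mult_pos[OF _ nx0] by auto
      have "0 < norm x * sin t" using x12(2) xb kl by linarith
      then have st0: "0 < sin t" using zero_less_mult_pos[OF _ nx0] by auto
      have "norm x * sin t \<le> 2 * (\<kappa> * l)" using xb x12(2) by linarith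
      also have "\<dots> = l / 4 * (8 * \<kappa>)" by simp
      also have "\<dots> \<le> norm x * (8 * \<kappa>)" using nx1 \<kappa> by (intro mult_right_mono) auto
      finally have "norm x * sin t \<le> norm x * (8 * \<kappa>)" .
      then have st: "sin t \<le> 8 * \<kappa>" using nx0 by simp
      have "1 - cos t \<le> (1 - cos t) * (1 + cos t)" using ct mult_left_mono[of 1 "1 + cos t" "1 - cos t"] by simp
      also have "\<dots> = (sin t)\<^sup>2" using sin_squared_eq[of t] by (simp add: power2_eq_square algebra_simps)
      also have "\<dots> \<le> sin t" using st0 by (simp add: power2_eq_square mult_left_le)
      finally have cs: "\<bar>cos t - 1\<bar> \<le> \<eta>" "\<bar>sin t\<bar> \<le> \<eta>" using ct st st0 \<kappa> by linarith+
      have "(l / 4)\<^sup>2 \<le> (?g t)\<^sup>2" using nx1 t(4) l by (intro power_mono) auto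
      then have \<delta>g: "\<delta> \<le> 16 * (?g t)\<^sup>2" by (simp add: \<delta>_def power_divide)
      define b where "b = polar (?g t) t"
      have "1 / norm x \<le> 4 / l" using nx1 nx0 l by (simp add: field_simps)
      then have "log 2 (1 / norm x) \<le> log 2 (4 / l)" using nx0 by (intro log_mono) auto
      also have "4 / l = 2 ^ (m + 2)" by (simp add: l_def power_one_over power_add)
      also have "log 2 (2 ^ (m + 2)) = real m + 2" by (subst log_nat_power) auto
      finally have lg: "log 2 (1 / norm x) \<le> real m + 2" .
      have "0 \<le> log 2 (1 / norm x)"
      proof -
        have "l \<le> 1" unfolding l_def by (rule power_le_one) auto
        then show ?thesis using nx2 nx0 by (simp add: zero_le_log_cancel_iff)
      qed
      with lg have "(norm x)\<^sup>2 * (log 2 (1 / norm x))\<^sup>2 \<le> l\<^sup>2 * (real m + 2)\<^sup>2"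
        using nx2 nx0 by (intro mult_mono power_mono) auto
      then have db: "dist x b \<le> 96 * (real m + 2)\<^sup>2 * \<delta>"
        using dist_t by (simp add: b_def \<delta>_def mult_ac)
      let ?D = "cball (b + \<delta> *\<^sub>R z0) (\<delta> * \<eta>)"
      have sub: "?D \<subseteq> A \<inter> cball x R"
      proof
        fix y assume y: "y \<in> ?D"
        define z where "z = (1 / \<delta>) *\<^sub>R (y - b)"
        have yz: "y = b + \<delta> *\<^sub>R z" using \<delta> by (simp add: z_def)
        have "\<delta> * norm (z - z0) = norm (\<delta> *\<^sub>R (z - z0))" using \<delta> by simp
        also have "\<dots> = dist (b + \<delta> *\<^sub>R z0) y" by (simp add: yz dist_norm scaleR_diff_right norm_minus_commute)
        also have "\<dots> \<le> \<delta> * \<eta>" using y by simp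
        finally have nz0: "norm (z - z0) \<le> \<eta>" using \<delta> by simp
        have large: "c \<le> norm (spiral_conv \<phi> \<delta> y)"
          unfolding yz b_def by (rule low) (use t \<delta> \<delta>g cs nz0 in auto)
        have "dist x y \<le> dist x b + norm (\<delta> *\<^sub>R z)"
          using dist_triangle[of x y b] by (simp add: yz dist_norm)
        also have "norm (\<delta> *\<^sub>R z) \<le> \<delta> * (norm z0 + \<eta>)"
          using nz0 \<delta> norm_triangle_sub[of z z0] by simp
        also have "\<dots> \<le> (norm z0 + \<eta>) * (real m + 2)\<^sup>2 * \<delta>"
        proof -
          have "1\<^sup>2 \<le> (real m + 2)\<^sup>2" by (intro power_mono) auto
          then have "(norm z0 + \<eta>) * \<delta> * 1 \<le> (norm z0 + \<eta>) * \<delta> * (real m + 2)\<^sup>2"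
            using \<eta> \<delta> by (intro mult_left_mono) auto
          then show ?thesis by (simp add: mult_ac)
        qed
        finally have "dist x y \<le> R" using db by (simp add: R_def C_def algebra_simps)
        moreover from this have "\<bar>x $ 1 - y $ 1\<bar> \<le> \<kappa> * l / 2" "\<bar>x $ 2 - y $ 2\<bar> \<le> \<kappa> * l / 2"
          using R component_le_norm_cart[of "x - y" 1] component_le_norm_cart[of "x - y" 2]
          by (simp_all add: dist_norm)
        then have "y \<in> cube" unfolding cube_def using xb kl l by (simp; linarith)
        ultimately show "y \<in> A \<inter> cball x R" using large by (simp add: A_def)
      qed
      have "ennreal (pi * (\<delta> * \<eta>)\<^sup>2) = emeasure lborel ?D"
        using \<delta> \<eta> by (simp add: emeasure_cball unit_ball_vol_2)
      also have "\<dots> \<le> emeasure lborel (A \<inter> cball x R)"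
        by (rule emeasure_mono[OF sub]) auto
      finally show ?thesis .
    qed
    have "ennreal (pi * (\<delta> * \<eta>)\<^sup>2) * emeasure lborel S \<le> ennreal (pi * R\<^sup>2) * emeasure lborel A"
      using R0 dens by (intro emeasure_density_points) auto
    then have "ennreal (pi * (\<delta> * \<eta>)\<^sup>2 * (l / 4 * (\<kappa> * l))) \<le> ennreal (pi * R\<^sup>2) * emeasure lborel A"
      unfolding mS using l kl by (subst ennreal_mult) auto
    then have "ennreal (pi * (\<delta> * \<eta>)\<^sup>2 * (l / 4 * (\<kappa> * l))) / ennreal (pi * R\<^sup>2) \<le> emeasure lborel A"
      using R0 by (intro divide_le_posI_ennreal) auto
    also have "ennreal (pi * (\<delta> * \<eta>)\<^sup>2 * (l / 4 * (\<kappa> * l))) / ennreal (pi * R\<^sup>2) =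
        ennreal (pi * (\<delta> * \<eta>)\<^sup>2 * (l / 4 * (\<kappa> * l)) / (pi * R\<^sup>2))"
      using R0 l kl by (intro divide_ennreal) auto
    also have "pi * (\<delta> * \<eta>)\<^sup>2 * (l / 4 * (\<kappa> * l)) / (pi * R\<^sup>2) = K * \<delta> / (real m + 2) ^ 4"
    proof -
      have "(real m + 2) ^ 4 = ((real m + 2)\<^sup>2)\<^sup>2" by simp
      then show ?thesis
        using \<delta> C by (simp add: R_def K_def \<delta>_def power_mult_distrib divide_simps) (simp add: power2_eq_square mult_ac)
    qed
    finally show "\<exists>A \<in> sets borel. A \<subseteq> dyadic_cube (int m) 0 \<and>
       (\<forall>x\<in>A. c \<le> norm (spiral_conv \<phi> ((1/2) ^ (2 * m)) x)) \<and>
       ennreal (K * (1/2) ^ (2 * m) / (real m + 2) ^ 4) \<le> emeasure lborel A"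
      unfolding \<delta>(2) using A cube_sub by (intro bexI[of _ A]) (auto simp: A_def)
  qed
  moreover have "0 < K" using \<kappa> \<eta> C by (simp add: K_def)
  ultimately show ?thesis using c that by blast
qed

section \<open>Schwartz functions and the distribution of the spiral\<close>

lemma partial_derivs_Nil [simp]: "partial_derivs [] f = f"
  by (simp add: partial_derivs_def)

lemma partial_derivs_Cons: "partial_derivs (i # is) f = partial_deriv i (partial_derivs is f)"
  by (simp add: partial_derivs_def)

lemma partial_deriv_affine:
  fixes D :: "real^'n::finite \<Rightarrow> complex"
  assumes D: "D differentiable (at (a *\<^sub>R y + b))"
  shows "partial_deriv i (\<lambda>y. C * D (a *\<^sub>R y + b)) y = C * of_real a * partial_deriv i D (a *\<^sub>R y + b)"
proof -
  obtain D' where D': "(D has_derivative D') (at (a *\<^sub>R y + b))" using D by (auto simp: differentiable_def)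
  interpret D': bounded_linear D' using D' by (rule has_derivative_bounded_linear)
  have line: "((\<lambda>t. D (s *\<^sub>R (q + t *\<^sub>R axis i 1) + b')) has_vector_derivative s *\<^sub>R D' (axis i 1)) (at 0)"
    if "s *\<^sub>R q + b' = a *\<^sub>R y + b" for s q b'
  proof -
    have "((\<lambda>t. s *\<^sub>R (q + t *\<^sub>R axis i 1) + b') has_derivative (\<lambda>t. s *\<^sub>R (t *\<^sub>R axis i 1))) (at 0)"
      by (auto intro!: derivative_eq_intros)
    moreover have "(D has_derivative D') (at (s *\<^sub>R (q + 0 *\<^sub>R axis i 1) + b'))" using D' that by simp
    ultimately have "((\<lambda>t. D (s *\<^sub>R (q + t *\<^sub>R axis i 1) + b')) has_derivative (\<lambda>t. D' (s *\<^sub>R (t *\<^sub>R axis i 1)))) (at 0)"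
      by (rule has_derivative_compose)
    then show ?thesis by (simp add: has_vector_derivative_def D'.scaleR mult.commute)
  qed
  have "partial_deriv i D (a *\<^sub>R y + b) = D' (axis i 1)"
    unfolding partial_deriv_def using line[of 1 "a *\<^sub>R y + b" 0] by (intro vector_derivative_at) simp
  moreover have "((\<lambda>t. C * D (a *\<^sub>R (y + t *\<^sub>R axis i 1) + b)) has_vector_derivative C * (a *\<^sub>R D' (axis i 1))) (at 0)"
    using line[OF refl] by (rule has_vector_derivative_mult_right)
  ultimately show ?thesis
    unfolding partial_deriv_def by (simp add: vector_derivative_at scaleR_conv_of_real)
qed

lemma schwartz_differentiable: "f \<in> schwartz \<Longrightarrow> partial_derivs is f differentiable (at x)"
  by (auto simp: schwartz_def differentiable_on_def)

lemma partial_derivs_affine: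
  fixes \<phi> :: "real^'n::finite \<Rightarrow> complex"
  assumes "\<phi> \<in> schwartz"
  shows "partial_derivs is (\<lambda>y. C * \<phi> (a *\<^sub>R y + b)) =
    (\<lambda>y. C * of_real a ^ length is * partial_derivs is \<phi> (a *\<^sub>R y + b))"
proof (induction "is")
  case Nil then show ?case by simp
next
  case (Cons i "is")
  show ?case
    unfolding partial_derivs_Cons Cons.IH
    by (rule ext, subst partial_deriv_affine[OF schwartz_differentiable[OF assms]]) (simp add: mult_ac)
qed

text \<open>The convolution with a distribution tests it with reflected, translated and dilated copies of \<open>\<phi>\<close>.\<close>

lemma schwartz_affine:
  fixes \<phi> :: "real^'n::finite \<Rightarrow> complex"
  assumes \<phi>: "\<phi> \<in> schwartz" and a: "a \<noteq> 0"
  shows "(\<lambda>y. C * \<phi> (a *\<^sub>R y + b)) \<in> schwartz"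
proof -
  have diff: "partial_derivs is (\<lambda>y. C * \<phi> (a *\<^sub>R y + b)) differentiable_on UNIV" for "is"
  proof -
    have "(\<lambda>y. partial_derivs is \<phi> (a *\<^sub>R y + b)) differentiable (at y)" for y
    proof -
      have "(partial_derivs is \<phi> \<circ> (\<lambda>y. a *\<^sub>R y + b)) differentiable (at y)"
        using schwartz_differentiable[OF \<phi>] by (intro differentiable_chain_at) (auto intro!: derivative_intros)
      then show ?thesis by (simp add: o_def)
    qed
    then show ?thesis
      unfolding partial_derivs_affine[OF \<phi>] by (auto simp: differentiable_on_def intro!: derivative_intros)
  qed
  have bdd: "bounded (range (\<lambda>x. (1 + norm x) ^ N *\<^sub>R partial_derivs is (\<lambda>y. C * \<phi> (a *\<^sub>R y + b)) x))" for "is" N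
  proof -
    have "bounded (range (\<lambda>x. (1 + norm x) ^ N *\<^sub>R partial_derivs is \<phi> x))"
      using \<phi> by (auto simp: schwartz_def)
    then obtain B where B: "\<And>x. (1 + norm x) ^ N * norm (partial_derivs is \<phi> x) \<le> B"
      by (force simp: bounded_iff)
    define K where "K = 1 + (1 + norm b) / \<bar>a\<bar>"
    have K: "0 \<le> K" by (simp add: K_def add_nonneg_nonneg)
    have cmp: "1 + norm y \<le> K * (1 + norm (a *\<^sub>R y + b))" for y
    proof -
      have "\<bar>a\<bar> * norm y \<le> norm (a *\<^sub>R y + b) + norm b"
        using norm_triangle_ineq4[of "a *\<^sub>R y + b" b] by simp
      then have "norm y \<le> (norm (a *\<^sub>R y + b) + norm b) / \<bar>a\<bar>" using a by (simp add: field_simps)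
      also have "\<dots> \<le> ((1 + norm b) * (1 + norm (a *\<^sub>R y + b))) / \<bar>a\<bar>"
        by (intro divide_right_mono) (auto simp: algebra_simps)
      finally have "norm y \<le> (1 + norm b) / \<bar>a\<bar> * (1 + norm (a *\<^sub>R y + b))" by simp
      moreover have "0 \<le> norm (a *\<^sub>R y + b)" by simp
      ultimately show ?thesis unfolding K_def distrib_right[of 1] mult_1 by linarith
    qed
    show ?thesis unfolding bounded_iff
    proof (intro exI ballI)
      fix v assume "v \<in> range (\<lambda>x. (1 + norm x) ^ N *\<^sub>R partial_derivs is (\<lambda>y. C * \<phi> (a *\<^sub>R y + b)) x)"
      then obtain y where v: "v = (1 + norm y) ^ N *\<^sub>R (C * of_real a ^ length is * partial_derivs is \<phi> (a *\<^sub>R y + b))"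
        unfolding partial_derivs_affine[OF \<phi>] by blast
      define E where "E = norm C * \<bar>a\<bar> ^ length is"
      have E: "0 \<le> E" by (simp add: E_def)
      have "norm v = (1 + norm y) ^ N * (E * norm (partial_derivs is \<phi> (a *\<^sub>R y + b)))"
        by (simp add: v E_def norm_mult norm_power)
      also have "\<dots> \<le> (K * (1 + norm (a *\<^sub>R y + b))) ^ N * (E * norm (partial_derivs is \<phi> (a *\<^sub>R y + b)))"
        using E cmp by (intro mult_right_mono power_mono) auto
      also have "\<dots> = (K ^ N * E) * ((1 + norm (a *\<^sub>R y + b)) ^ N * norm (partial_derivs is \<phi> (a *\<^sub>R y + b)))"
        by (simp add: power_mult_distrib mult_ac)
      also have "\<dots> \<le> (K ^ N * E) * B" using E K by (intro mult_left_mono B) auto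
      finally show "norm v \<le> (K ^ N * E) * B" .
    qed
  qed
  show ?thesis using diff bdd by (simp add: schwartz_def)
qed

lemma partial_derivs_add:
  fixes f g :: "real^'n::finite \<Rightarrow> complex"
  assumes "f \<in> schwartz" "g \<in> schwartz"
  shows "partial_derivs is (\<lambda>x. f x + g x) = (\<lambda>x. partial_derivs is f x + partial_derivs is g x)"
proof (induction "is")
  case Nil then show ?case by simp
next
  case (Cons i "is")
  show ?case
  proof (rule ext)
    fix x
    have d: "(\<lambda>t. partial_derivs is h (x + t *\<^sub>R axis i 1)) differentiable (at 0)"
      if "h \<in> schwartz" for h :: "real^'n \<Rightarrow> complex"
    proof -
      have "(partial_derivs is h \<circ> (\<lambda>t. x + t *\<^sub>R axis i 1)) differentiable (at 0)"
        using schwartz_differentiable[OF that] by (intro differentiable_chain_at) (auto intro!: derivative_intros)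
      then show ?thesis by (simp add: o_def)
    qed
    show "partial_derivs (i # is) (\<lambda>x. f x + g x) x = partial_derivs (i # is) f x + partial_derivs (i # is) g x"
      unfolding partial_derivs_Cons Cons.IH partial_deriv_def
      using d[OF assms(1)] d[OF assms(2)] by (rule vector_derivative_add_at)
  qed
qed

lemma schwartz_add:
  fixes f g :: "real^'n::finite \<Rightarrow> complex"
  assumes "f \<in> schwartz" "g \<in> schwartz"
  shows "(\<lambda>x. f x + g x) \<in> schwartz"
proof -
  have "bounded (range (\<lambda>x. (1 + norm x) ^ N *\<^sub>R partial_derivs is (\<lambda>x. f x + g x) x))" for "is" N
    using bounded_plus_comp[of "\<lambda>x. (1 + norm x) ^ N *\<^sub>R partial_derivs is f x" UNIV "\<lambda>x. (1 + norm x) ^ N *\<^sub>R partial_derivs is g x"] assms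
    unfolding partial_derivs_add[OF assms] by (simp add: schwartz_def scaleR_add_right)
  moreover have "partial_derivs is (\<lambda>x. f x + g x) differentiable_on UNIV" for "is"
    using assms unfolding partial_derivs_add[OF assms] by (auto simp: schwartz_def)
  ultimately show ?thesis by (simp add: schwartz_def)
qed

lemma schwartz_bound:
  fixes \<phi> :: "real^'n::finite \<Rightarrow> complex"
  assumes "\<phi> \<in> schwartz"
  obtains B where "0 \<le> B" "\<And>x. (1 + norm x) ^ N * norm (\<phi> x) \<le> B"
proof -
  have "bounded (range (\<lambda>x. (1 + norm x) ^ N *\<^sub>R partial_derivs [] \<phi> x))"
    using assms unfolding schwartz_def by blast
  then obtain B where B: "\<And>x. (1 + norm x) ^ N * norm (\<phi> x) \<le> B" by (force simp: bounded_iff)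
  moreover have "0 \<le> (1 + norm (0::real^'n)) ^ N * norm (\<phi> 0)" by simp
  then have "0 \<le> B" using B[of 0] by (rule order_trans)
  ultimately show ?thesis using that by blast
qed

lemma borel_measurable_schwartz:
  assumes "\<phi> \<in> schwartz" shows "\<phi> \<in> borel_measurable borel"
proof -
  have "\<phi> differentiable (at x)" for x using schwartz_differentiable[OF assms, of "[]"] by simp
  then have "continuous_on UNIV \<phi>"
    by (intro differentiable_imp_continuous_on) (simp add: differentiable_on_def)
  then show ?thesis by (rule borel_measurable_continuous_onI)
qed

lemma ennreal_term_le_suminf: "F k \<le> suminf F" for F :: "nat \<Rightarrow> ennreal"
  using sum_le_suminf[of F "{k}"] by simp

text \<open>Bound the function on the annulus where \<open>k \<le> norm x \<le> k + 1\<close> by a multiple of the indicator of a disc of area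
\<open>\<pi> (k + 1)\<^sup>2\<close>, and sum over \<open>k\<close>.\<close>

lemma integrable_decay: "integrable lborel (\<lambda>x::real^2. 1 / (1 + norm x) ^ 4)"
proof (rule integrableI_bounded)
  show "(\<lambda>x::real^2. 1 / (1 + norm x) ^ 4) \<in> borel_measurable lborel" by measurable
  have "(\<integral>\<^sup>+x. ennreal (norm (1 / (1 + norm (x::real^2)) ^ 4)) \<partial>lborel)
     \<le> (\<integral>\<^sup>+x. (\<Sum>k. ennreal (1 / (real k + 1) ^ 4) * indicator (cball 0 (real k + 1)) (x::real^2)) \<partial>lborel)"
  proof (rule nn_integral_mono)
    fix x :: "real^2"
    define k where "k = nat \<lfloor>norm x\<rfloor>"
    have k: "real k \<le> norm x" "norm x \<le> real k + 1" using norm_ge_zero[of x] unfolding k_def by linarith+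
    have "ennreal (norm (1 / (1 + norm x) ^ 4)) \<le> ennreal (1 / (real k + 1) ^ 4) * indicator (cball 0 (real k + 1)) x"
      using k by (auto simp: indicator_def intro!: ennreal_leI divide_left_mono power_mono)
    also have "\<dots> \<le> (\<Sum>k. ennreal (1 / (real k + 1) ^ 4) * indicator (cball 0 (real k + 1)) x)"
      by (rule ennreal_term_le_suminf[of "\<lambda>k. ennreal (1 / (real k + 1) ^ 4) * indicator (cball 0 (real k + 1)) x"])
    finally show "ennreal (norm (1 / (1 + norm x) ^ 4)) \<le> \<dots>" .
  qed
  also have "\<dots> = (\<Sum>k. \<integral>\<^sup>+x. ennreal (1 / (real k + 1) ^ 4) * indicator (cball 0 (real k + 1)) (x::real^2) \<partial>lborel)"
    by (intro nn_integral_suminf borel_measurable_times_ennreal borel_measurable_const borel_measurable_indicator) auto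
  also have "\<dots> = (\<Sum>k. ennreal (pi * (1 / (real k + 1)\<^sup>2)))"
  proof (intro suminf_cong)
    fix k
    have "(\<integral>\<^sup>+x. ennreal (1 / (real k + 1) ^ 4) * indicator (cball 0 (real k + 1)) (x::real^2) \<partial>lborel)
        = ennreal (1 / (real k + 1) ^ 4) * ennreal (pi * (real k + 1)\<^sup>2)"
      by (subst nn_integral_cmult_indicator) (auto simp: emeasure_cball unit_ball_vol_2)
    also have "\<dots> = ennreal (1 / (real k + 1) ^ 4 * (pi * (real k + 1)\<^sup>2))"
      by (rule ennreal_mult [symmetric]) auto
    also have "1 / (real k + 1) ^ 4 * (pi * (real k + 1)\<^sup>2) = pi * (1 / (real k + 1)\<^sup>2)"
      by (simp add: field_simps flip: power_add)
    finally show "(\<integral>\<^sup>+x. ennreal (1 / (real k + 1) ^ 4) * indicator (cball 0 (real k + 1)) (x::real^2) \<partial>lborel) = ennreal (pi * (1 / (real k + 1)\<^sup>2))" .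
  qed
  also have "\<dots> < \<infinity>"
  proof -
    have "summable (\<lambda>k. inverse ((real (Suc k)) ^ 2))"
      using inverse_power_summable[of 2, where 'a = real] by (subst summable_Suc_iff) auto
    then have "summable (\<lambda>k. pi * (1 / (real k + 1)\<^sup>2))"
      by (intro summable_mult) (simp add: inverse_eq_divide add.commute)
    then show ?thesis by (subst suminf_ennreal2) auto
  qed
  finally show "(\<integral>\<^sup>+x. ennreal (norm (1 / (1 + norm (x::real^2)) ^ 4)) \<partial>lborel) < \<infinity>" .
qed

lemma schwartz_integrable:
  fixes \<phi> :: "real^2 \<Rightarrow> complex"
  assumes \<phi>: "\<phi> \<in> schwartz"
  shows "integrable lborel \<phi>" "integrable lborel (\<lambda>w. norm w * norm (\<phi> w))"
proof -
  have [measurable]: "\<phi> \<in> borel_measurable borel" by (rule borel_measurable_schwartz[OF \<phi>])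
  obtain B where B: "0 \<le> B" "\<And>x. (1 + norm x) ^ 5 * norm (\<phi> x) \<le> B" using schwartz_bound[OF \<phi>] by blast
  have b: "norm x * norm (\<phi> x) \<le> B * (1 / (1 + norm x) ^ 4)" "norm (\<phi> x) \<le> B * (1 / (1 + norm x) ^ 4)" for x
  proof -
    have "0 < 1 + norm x" by (intro add_pos_nonneg) auto
    then have pos: "0 < (1 + norm x) ^ 4" by (rule zero_less_power)
    have "(1 + norm x) * norm (\<phi> x) * (1 + norm x) ^ 4 \<le> B"
      using B(2)[of x] by (simp add: eval_nat_numeral mult_ac)
    then have *: "(1 + norm x) * norm (\<phi> x) \<le> B / (1 + norm x) ^ 4"
      unfolding pos_le_divide_eq[OF pos] .
    have "norm x * norm (\<phi> x) \<le> (1 + norm x) * norm (\<phi> x)" "1 * norm (\<phi> x) \<le> (1 + norm x) * norm (\<phi> x)"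
      by (intro mult_right_mono; simp)+
    with * show "norm x * norm (\<phi> x) \<le> B * (1 / (1 + norm x) ^ 4)" "norm (\<phi> x) \<le> B * (1 / (1 + norm x) ^ 4)" by simp_all
  qed
  have i: "integrable lborel (\<lambda>x::real^2. B * (1 / (1 + norm x) ^ 4))" by (intro integrable_mult_right integrable_decay)
  have n: "0 \<le> B * (1 / (1 + norm x) ^ 4)" for x :: "real^2" using B by simp
  have nn: "norm (B * (1 / (1 + norm x) ^ 4)) = B * (1 / (1 + norm x) ^ 4)" for x :: "real^2"
    using n[of x] by (simp only: real_norm_def abs_of_nonneg)
  show "integrable lborel \<phi>"
    by (rule Bochner_Integration.integrable_bound[OF i _ AE_I2]) (measurable, simp only: nn b(2))
  have "norm (norm x * norm (\<phi> x)) = norm x * norm (\<phi> x)" for x by simp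
  then show "integrable lborel (\<lambda>w. norm w * norm (\<phi> w))"
    by (intro Bochner_Integration.integrable_bound[OF i _ AE_I2]) (measurable, simp only: nn b(1))
qed

lemma integral_lborel_affine:
  fixes f :: "'a::euclidean_space \<Rightarrow> complex"
  assumes [measurable]: "f \<in> borel_measurable borel" and c: "c \<noteq> 0"
  shows "(\<integral>x. f x \<partial>lborel) = (\<integral>w. of_real (\<bar>c\<bar> ^ DIM('a)) * f (t + c *\<^sub>R w) \<partial>lborel)"
  by (subst lborel_affine[OF c, of t], subst integral_density)
     (auto simp: integral_distr scaleR_conv_of_real)

lemma conv_distribution_spiral:
  fixes \<phi>0 \<phi> :: "real^2 \<Rightarrow> complex"
  assumes s: "\<phi>0 \<in> schwartz" "\<phi> \<in> schwartz"
  shows "conv_distribution (dilated_family \<phi>0 \<phi> j) (regular_distribution (indicator spiral)) x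
    = spiral_conv (if j = 0 then \<phi>0 else \<phi>) ((1/2) ^ j) x"
proof -
  define \<psi> where "\<psi> = (if j = 0 then \<phi>0 else \<phi>)"
  have \<psi>: "\<psi> \<in> schwartz" using s by (simp add: \<psi>_def)
  have [measurable]: "\<psi> \<in> borel_measurable borel" by (rule borel_measurable_schwartz[OF \<psi>])
  define a :: real where "a = 2 ^ j"
  have a: "0 < a" by (simp add: a_def)
  have fam: "dilated_family \<phi>0 \<phi> j y = of_real (a\<^sup>2) * \<psi> (a *\<^sub>R y)" for y
    by (auto simp: dilated_family_def \<psi>_def a_def power_mult)
  have eq: "(\<lambda>y. dilated_family \<phi>0 \<phi> j (x - y)) = (\<lambda>y. of_real (a\<^sup>2) * \<psi> ((- a) *\<^sub>R y + a *\<^sub>R x))"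
    unfolding fam by (simp add: scaleR_diff_right)
  have "(\<lambda>y. dilated_family \<phi>0 \<phi> j (x - y)) \<in> schwartz"
    unfolding eq using a by (intro schwartz_affine[OF \<psi>]) auto
  then have "conv_distribution (dilated_family \<phi>0 \<phi> j) (regular_distribution (indicator spiral)) x
      = (\<integral>y. indicator spiral y * (of_real (a\<^sup>2) * \<psi> ((- a) *\<^sub>R y + a *\<^sub>R x)) \<partial>lebesgue)"
    unfolding conv_distribution_def regular_distribution_def by (simp add: eq)
  also have "\<dots> = (\<integral>y. indicator spiral y * (of_real (a\<^sup>2) * \<psi> ((- a) *\<^sub>R y + a *\<^sub>R x)) \<partial>lborel)"
    by (rule integral_completion) measurable
  also have "\<dots> = (\<integral>w. of_real (\<bar>- (1 / a)\<bar> ^ DIM(real^2)) * (indicator spiral (x + (- (1 / a)) *\<^sub>R w) *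
      (of_real (a\<^sup>2) * \<psi> ((- a) *\<^sub>R (x + (- (1 / a)) *\<^sub>R w) + a *\<^sub>R x))) \<partial>lborel)"
    using a by (intro integral_lborel_affine) auto
  also have "\<dots> = spiral_conv \<psi> (1 / a) x"
    unfolding spiral_conv_def
  proof (intro Bochner_Integration.integral_cong refl)
    fix w :: "real^2"
    have 1: "(- a) *\<^sub>R (x + (- (1 / a)) *\<^sub>R w) + a *\<^sub>R x = w" using a by (simp add: algebra_simps)
    have 2: "x + (- (1 / a)) *\<^sub>R w = x - (1 / a) *\<^sub>R w" by simp
    have 3: "complex_of_real (\<bar>- (1 / a)\<bar> ^ DIM(real^2)) * of_real (a\<^sup>2) = 1"
      using a by (simp add: power_divide flip: of_real_mult of_real_power)
    have 4: "u * (i * (v * p)) = (u * v) * (p * i)" for u i v p :: complex by (simp only: mult_ac)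
    show "of_real (\<bar>- (1 / a)\<bar> ^ DIM(real^2)) * (indicator spiral (x + (- (1 / a)) *\<^sub>R w) *
      (of_real (a\<^sup>2) * \<psi> ((- a) *\<^sub>R (x + (- (1 / a)) *\<^sub>R w) + a *\<^sub>R x))) = \<psi> w * indicator spiral (x - (1 / a) *\<^sub>R w)"
      unfolding 1 unfolding 4 3 unfolding 2 by simp
  qed
  also have "1 / a = (1/2) ^ j" by (simp add: a_def power_one_over)
  finally show ?thesis unfolding \<psi>_def .
qed

text \<open>The functional is bounded by the area of the spiral times the supremum of the test function, which is the
seminorm of order 0.\<close>

lemma regular_distribution_spiral_tempered:
  "regular_distribution (indicator spiral) \<in> (tempered_distributions :: ((real^2 \<Rightarrow> complex) \<Rightarrow> complex) set)"
proof -
  let ?T = "regular_distribution (indicator spiral) :: (real^2 \<Rightarrow> complex) \<Rightarrow> complex"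
  have fin: "emeasure lborel spiral < \<infinity>"
    using emeasure_mono[OF spiral_subset_cball, of lborel] emeasure_lborel_cball_finite[of "0::real^2" "1/2"]
    by (simp add: less_le_trans le_less_trans)
  have int: "integrable lborel (\<lambda>x. indicator spiral x * f x)" if f: "f \<in> schwartz" for f :: "real^2 \<Rightarrow> complex"
  proof -
    have [measurable]: "f \<in> borel_measurable borel" by (rule borel_measurable_schwartz[OF f])
    show ?thesis
      by (rule Bochner_Integration.integrable_bound[OF schwartz_integrable(1)[OF f]]) (auto simp: indicator_def)
  qed
  have T: "?T f = (\<integral>x. indicator spiral x * f x \<partial>lborel)" if f: "f \<in> schwartz" for f
  proof -
    have [measurable]: "f \<in> borel_measurable borel" by (rule borel_measurable_schwartz[OF f])
    show ?thesis using f unfolding regular_distribution_def by (simp add: integral_completion)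
  qed
  have add: "?T (\<lambda>x. f x + g x) = ?T f + ?T g" if f: "f \<in> schwartz" and g: "g \<in> schwartz" for f g
    unfolding T[OF f] T[OF g] T[OF schwartz_add[OF f g]] using int[OF f] int[OF g]
    by (simp add: distrib_left)
  have scale: "?T (\<lambda>x. c * f x) = c * ?T f" if f: "f \<in> schwartz" for c f
  proof -
    have "(\<lambda>x. c * f x) \<in> schwartz" using schwartz_affine[OF f, of 1 c 0] by simp
    then show ?thesis using f T by (simp add: mult.left_commute)
  qed
  have bound: "norm (?T f) \<le> measure lborel spiral * (\<Sum>is \<in> {is. length is \<le> 0}. schwartz_seminorm 0 is f)" if f: "f \<in> schwartz" for f
  proof -
    obtain B where B: "\<And>x. norm (f x) \<le> B" using schwartz_bound[OF f, of 0] by auto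
    have le: "norm (f x) \<le> schwartz_seminorm 0 [] f" for x
      unfolding schwartz_seminorm_def using B by (auto intro!: cSUP_upper bdd_aboveI[of _ B])
    have [measurable]: "f \<in> borel_measurable borel" by (rule borel_measurable_schwartz[OF f])
    have "norm (?T f) \<le> (\<integral>x. norm (indicator spiral x * f x) \<partial>lborel)"
      unfolding T[OF f] by (rule integral_norm_bound)
    also have "\<dots> \<le> (\<integral>x. schwartz_seminorm 0 [] f * indicator spiral x \<partial>lborel)"
      using fin le by (intro integral_mono integrable_norm int f integrable_mult_right integrable_real_indicator) (auto simp: indicator_def)
    also have "\<dots> = measure lborel spiral * schwartz_seminorm 0 [] f" using fin by simp
    finally show ?thesis by simp
  qed
  show ?thesis
    unfolding tempered_distributions_def mem_Collect_eq
  proof (intro conjI ballI allI)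
    show "?T \<in> extensional schwartz" by (simp add: regular_distribution_def)
    show "\<exists>C N. \<forall>f\<in>schwartz. norm (?T f) \<le> C * (\<Sum>is \<in> {is. length is \<le> N}. schwartz_seminorm N is f)"
      using bound by blast
  qed (rule add scale; assumption)+
qed

section \<open>The Besov-type norm of the spiral\<close>

text \<open>A half-open cube lies between the open and the closed box with the same corners, which have the same
measure.\<close>

lemma dyadic_cube_measure:
  fixes k :: "int^2"
  shows "dyadic_cube m k \<in> sets borel" "emeasure lborel (dyadic_cube m k) = ennreal (2 powr (- 2 * of_int m))"
    "measure lebesgue (dyadic_cube m k) = 2 powr (- 2 * of_int m)"
proof -
  define l :: real where "l = 2 powi (- m)"
  have l: "0 < l" by (simp add: l_def)
  have l2: "l * l = 2 powr (- 2 * of_int m)"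
    by (simp add: l_def powr_real_of_int' powr_add [symmetric] flip: powr_real_of_int')
  define a :: "real^2" where "a = (\<chi> i. l * of_int (k $ i))"
  define b :: "real^2" where "b = (\<chi> i. l * (of_int (k $ i) + 1))"
  have cube: "dyadic_cube m k = {x. a $ 1 \<le> x $ 1 \<and> x $ 1 < b $ 1 \<and> a $ 2 \<le> x $ 2 \<and> x $ 2 < b $ 2}"
    by (auto simp: dyadic_cube_def a_def b_def l_def forall_2)
  have [measurable]: "(\<lambda>x::real^2. x $ i) \<in> borel_measurable borel" for i
    by (intro borel_measurable_continuous_onI continuous_intros)
  show meas: "dyadic_cube m k \<in> sets borel" unfolding cube by measurable
  have ab: "b $ i - a $ i = l" "a $ i < b $ i" for i using l by (auto simp: a_def b_def algebra_simps)
  have ne: "cbox a b \<noteq> {}" using ab(2) by (auto simp: interval_ne_empty_cart less_imp_le)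
  have c: "measure lborel (cbox a b) = l * l"
    using content_cbox_cart[OF ne] by (simp add: ab UNIV_2)
  have "emeasure lborel (cbox a b) < \<infinity>" by (rule emeasure_lborel_cbox_finite)
  then have "emeasure lborel (cbox a b) \<noteq> top" by simp
  from emeasure_eq_ennreal_measure[OF this] have ec: "emeasure lborel (cbox a b) = ennreal (l * l)" unfolding c .
  have eb: "emeasure lborel (box a b) = emeasure lborel (cbox a b)"
    by (simp add: emeasure_lborel_box_eq emeasure_lborel_cbox_eq)
  have "box a b \<subseteq> dyadic_cube m k" "dyadic_cube m k \<subseteq> cbox a b"
    unfolding cube by (auto simp: mem_box_cart forall_2 less_imp_le)
  then have "emeasure lborel (box a b) \<le> emeasure lborel (dyadic_cube m k)" "emeasure lborel (dyadic_cube m k) \<le> emeasure lborel (cbox a b)"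
    using meas by (auto intro!: emeasure_mono)
  then show e: "emeasure lborel (dyadic_cube m k) = ennreal (2 powr (- 2 * of_int m))"
    unfolding eb ec l2 by simp
  then show "measure lebesgue (dyadic_cube m k) = 2 powr (- 2 * of_int m)"
    using meas by (simp add: measure_def)
qed

lemma dyadic_cube_weight:
  fixes k :: "int^2"
  shows "1 / measure lebesgue (dyadic_cube m k) powr \<tau> = 2 powr (2 * of_int m * \<tau>)"
  unfolding dyadic_cube_measure(3) powr_powr by (simp add: powr_minus divide_inverse)

text \<open>The frequency 0 is outside the annulus that carries the Fourier transform of \<open>\<phi>\<close>.\<close>

lemma admissible_pair_mean_zero:
  fixes \<phi>0 \<phi> :: "real^2 \<Rightarrow> complex"
  assumes "admissible_pair \<phi>0 \<phi>"
  shows "(\<integral>w. \<phi> w \<partial>lborel) = 0"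
proof -
  have m: "\<phi> \<in> borel_measurable borel" using assms by (intro borel_measurable_schwartz) (simp add: admissible_pair_def)
  have "fourier \<phi> 0 = 0"
  proof (rule ccontr)
    assume "fourier \<phi> 0 \<noteq> 0"
    then have "0 \<in> closure {\<xi>. fourier \<phi> \<xi> \<noteq> 0}" by (intro subsetD[OF closure_subset]) simp
    moreover have "closure {\<xi>. fourier \<phi> \<xi> \<noteq> 0} \<subseteq> {\<xi>. 1/2 \<le> norm \<xi> \<and> norm \<xi> \<le> 2}"
      using assms unfolding admissible_pair_def by (elim conjE)
    ultimately have "(0::real^2) \<in> {\<xi>. 1/2 \<le> norm \<xi> \<and> norm \<xi> \<le> 2}" by (rule rev_subsetD)
    then show False by simp
  qed
  then have "(\<integral>w. \<phi> w \<partial>lebesgue) = 0" by (simp add: fourier_def)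
  then show ?thesis using m by (simp add: integral_completion)
qed

text \<open>Up to a constant factor, this is the Fourier transform of \<open>\<phi>\<close> at the first unit vector, whose
norm lies between \<open>3/5\<close> and \<open>5/3\<close>.\<close>

lemma admissible_pair_frequency:
  fixes \<phi>0 \<phi> :: "real^2 \<Rightarrow> complex"
  assumes "admissible_pair \<phi>0 \<phi>"
  shows "(\<integral>w. \<phi> w * exp (- \<i> * of_real (w $ 1)) \<partial>lborel) \<noteq> 0"
proof -
  have [measurable]: "\<phi> \<in> borel_measurable borel" using assms by (intro borel_measurable_schwartz) (simp add: admissible_pair_def)
  have [measurable]: "(\<lambda>w::real^2. w $ 1) \<in> borel_measurable borel"
    by (intro borel_measurable_continuous_onI continuous_intros)
  have [measurable]: "(\<lambda>x::real. exp (- \<i> * of_real x)) \<in> borel_measurable borel"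
    by (intro borel_measurable_continuous_onI continuous_intros)
  obtain C where C: "0 < C" "\<And>\<xi>. 3/5 \<le> norm \<xi> \<and> norm \<xi> \<le> 5/3 \<longrightarrow> C \<le> norm (fourier \<phi> \<xi>)"
    using assms unfolding admissible_pair_def by blast
  have "fourier \<phi> (axis 1 1) \<noteq> 0" using C(1) C(2)[of "axis 1 1"] by (auto simp: norm_axis_1)
  then have "(\<integral>w. \<phi> w * exp (- \<i> * of_real (w \<bullet> axis 1 1)) \<partial>lebesgue) \<noteq> 0"
    unfolding fourier_def by auto
  then show ?thesis
    by (simp add: inner_axis integral_completion)
qed

lemma Lp_quasinorm_ennreal:
  assumes "1 \<le> p"
  shows "Lp_quasinorm (ennreal p) P f = ennpowr (\<integral>\<^sup>+x. ennreal (norm (f x) powr p) * indicator P x \<partial>lborel) (1 / p)"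
  using assms by (simp add: Lp_quasinorm_def nn_integral_completion)

lemma ennpowr_mono: "0 \<le> a \<Longrightarrow> x \<le> y \<Longrightarrow> ennpowr x a \<le> ennpowr y a"
  by (auto simp: ennpowr_def top_unique intro!: ennreal_leI powr_mono2 enn2real_mono)
     (metis top.not_eq_extremum)

lemma ennpowr_ennreal: "0 \<le> x \<Longrightarrow> ennpowr (ennreal x) a = ennreal (x powr a)"
  by (simp add: ennpowr_def)

lemma besov_type_norm_infinity:
  "besov_type_norm \<phi>0 \<phi> s \<tau> p \<infinity> T =
     (SUP m :: int. SUP k. SUP j\<in>{nat m..}. ennreal (1 / measure lebesgue (dyadic_cube m k) powr \<tau>) *
        (ennreal (2 powr (real j * s)) * Lp_quasinorm p (dyadic_cube m k) (conv_distribution (dilated_family \<phi>0 \<phi> j) T)))"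
  unfolding besov_type_norm_def lq_quasinorm_def by (simp add: SUP_mult_left_ennreal)

text \<open>The first term in the minimum comes from the uniform bound of the functions, the second one from their \<open>L\<^sup>1\<close> norms, as
\<open>|f|\<^sup>p \<le> M\<^sup>p\<^sup>-\<^sup>1 |f|\<close> for a function bounded by \<open>M\<close>. At \<open>j = 0\<close> no cancellation is available, but
\<open>2\<^sup>-\<^sup>j = 1\<close>.\<close>

lemma spiral_conv_Lp_bound:
  fixes \<phi>0 \<phi> :: "real^2 \<Rightarrow> complex"
  assumes adm: "admissible_pair \<phi>0 \<phi>" and p: "1 \<le> p"
  obtains K where "0 < K"
    "\<And>j m k. (\<integral>\<^sup>+x. ennreal (norm (spiral_conv (if j = 0 then \<phi>0 else \<phi>) ((1/2) ^ j) x) powr p) * indicator (dyadic_cube m k) x \<partial>lborel)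
       \<le> ennreal (K * min (2 powr (- 2 * of_int m)) (2 powr (- real j)))"
proof -
  have s: "\<phi>0 \<in> schwartz" "\<phi> \<in> schwartz" using adm by (auto simp: admissible_pair_def)
  note i0 = schwartz_integrable[OF s(1)] and i = schwartz_integrable[OF s(2)]
  define n0 where "n0 = (\<integral>w. norm (\<phi>0 w) \<partial>lborel)"
  define n where "n = (\<integral>w. norm (\<phi> w) \<partial>lborel)"
  define n1 where "n1 = (\<integral>w. norm w * norm (\<phi> w) \<partial>lborel)"
  have nn: "0 \<le> n0" "0 \<le> n" "0 \<le> n1" by (auto simp: n0_def n_def n1_def intro!: Bochner_Integration.integral_nonneg)
  define M where "M = 1 + n0 + n"
  define L where "L = n0 + 4056 * n1"
  have M: "1 \<le> M" using nn by (simp add: M_def)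
  have L: "0 \<le> L" using nn by (simp add: L_def)
  \<comment> \<open>The summand 1 in \<open>M\<close> keeps \<open>K\<close> positive.\<close>
  define K where "K = M powr p + M powr (p - 1) * L"
  have K: "0 < K" unfolding K_def using M L by (intro add_pos_nonneg) auto
  show ?thesis
  proof (rule that[OF K])
    fix j m and k :: "int^2"
    define f where "f = spiral_conv (if j = 0 then \<phi>0 else \<phi>) ((1/2) ^ j)"
    have [measurable]: "f \<in> borel_measurable borel"
      unfolding f_def using s by (intro borel_measurable_spiral_conv borel_measurable_schwartz) auto
    have [measurable]: "dyadic_cube m k \<in> sets borel" by (rule dyadic_cube_measure)
    have fM: "norm (f x) \<le> M" for x
    proof -
      have "norm (spiral_conv \<phi>0 ((1/2)^j) x) \<le> n0" "norm (spiral_conv \<phi> ((1/2)^j) x) \<le> n"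
        unfolding n0_def n_def by (rule norm_spiral_conv_le[OF i0(1)], rule norm_spiral_conv_le[OF i(1)])
      then show ?thesis using nn unfolding f_def M_def by (cases "j = 0") auto
    qed
    have fL: "(\<integral>\<^sup>+x. ennreal (norm (f x)) \<partial>lborel) \<le> ennreal (L * 2 powr (- real j))"
    proof (cases "j = 0")
      case True
      then have "(\<integral>\<^sup>+x. ennreal (norm (f x)) \<partial>lborel) \<le> ennreal n0"
        unfolding f_def n0_def using spiral_conv_L1_trivial[OF i0(1)] by simp
      also have "\<dots> \<le> ennreal (L * 2 powr (- real j))" using True nn by (intro ennreal_leI) (simp add: L_def)
      finally show ?thesis .
    next
      case False
      then have "(\<integral>\<^sup>+x. ennreal (norm (f x)) \<partial>lborel) \<le> ennreal (4056 * (1/2) ^ j * n1)"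
        unfolding f_def n1_def using spiral_conv_L1_cancellation[OF i admissible_pair_mean_zero[OF adm], of "(1/2) ^ j"] by simp
      also have "\<dots> \<le> ennreal (L * 2 powr (- real j))"
      proof (rule ennreal_leI)
        have "4056 * (1/2) ^ j * n1 = 4056 * n1 * 2 powr (- real j)"
          by (simp add: powr_minus powr_realpow power_one_over inverse_eq_divide)
        also have "\<dots> \<le> L * 2 powr (- real j)" using nn by (intro mult_right_mono) (auto simp: L_def)
        finally show "4056 * (1/2) ^ j * n1 \<le> L * 2 powr (- real j)" .
      qed
      finally show ?thesis .
    qed
    let ?I = "\<integral>\<^sup>+x. ennreal (norm (f x) powr p) * indicator (dyadic_cube m k) x \<partial>lborel"
    have "?I \<le> (\<integral>\<^sup>+x. ennreal (M powr p) * indicator (dyadic_cube m k) x \<partial>lborel)"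
      using fM p by (intro nn_integral_mono mult_right_mono ennreal_leI powr_mono2) auto
    also have "\<dots> = ennreal (M powr p) * ennreal (2 powr (- 2 * of_int m))"
      by (subst nn_integral_cmult_indicator) (auto simp: dyadic_cube_measure)
    also have "\<dots> = ennreal (M powr p * 2 powr (- 2 * of_int m))" by (simp add: ennreal_mult)
    also have "\<dots> \<le> ennreal (K * 2 powr (- 2 * of_int m))"
      using L by (intro ennreal_leI mult_right_mono) (auto simp: K_def)
    finally have 1: "?I \<le> ennreal (K * 2 powr (- 2 * of_int m))" .
    have "?I \<le> (\<integral>\<^sup>+x. ennreal (M powr (p - 1)) * ennreal (norm (f x)) \<partial>lborel)"
    proof (rule nn_integral_mono)
      fix x
      have "norm (f x) powr p = norm (f x) powr (p - 1) * norm (f x)"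
        using powr_add[of "norm (f x)" "p - 1" 1] by simp
      also have "\<dots> \<le> M powr (p - 1) * norm (f x)"
        using fM p by (intro mult_right_mono powr_mono2) auto
      finally have "ennreal (norm (f x) powr p) \<le> ennreal (M powr (p - 1)) * ennreal (norm (f x))"
        by (simp add: ennreal_leI flip: ennreal_mult)
      then show "ennreal (norm (f x) powr p) * indicator (dyadic_cube m k) x \<le> ennreal (M powr (p - 1)) * ennreal (norm (f x))"
        by (auto simp: indicator_def)
    qed
    also have "\<dots> = ennreal (M powr (p - 1)) * (\<integral>\<^sup>+x. ennreal (norm (f x)) \<partial>lborel)"
      by (rule nn_integral_cmult) measurable
    also have "\<dots> \<le> ennreal (M powr (p - 1)) * ennreal (L * 2 powr (- real j))"
      by (intro mult_left_mono fL) auto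
    also have "\<dots> = ennreal (M powr (p - 1) * L * 2 powr (- real j))" using L by (simp add: ennreal_mult mult.assoc)
    also have "\<dots> \<le> ennreal (K * 2 powr (- real j))"
      by (intro ennreal_leI mult_right_mono) (auto simp: K_def)
    finally have 2: "?I \<le> ennreal (K * 2 powr (- real j))" .
    show "?I \<le> ennreal (K * min (2 powr (- 2 * of_int m)) (2 powr (- real j)))"
      using 1 2 by (simp add: min_def)
  qed
qed

text \<open>For \<open>m \<ge> 0\<close> the worst case is \<open>j = 2 m\<close>, where both terms in the minimum agree and the product is
\<open>2\<^sup>2\<^sup>m\<close> to the power \<open>\<tau> + s - 1 / p\<close>.\<close>

lemma besov_exponent_bound:
  fixes p s \<tau> :: real and m :: int and j :: nat
  assumes p: "1 \<le> p" and \<tau>: "0 \<le> \<tau>" and s: "0 < s" "\<tau> + s \<le> 1 / p" and j: "nat m \<le> j"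
  shows "2 powr (2 * of_int m * \<tau>) * (2 powr (real j * s) *
     (min (2 powr (- 2 * of_int m)) (2 powr (- real j))) powr (1 / p)) \<le> 1"
proof -
  have eq: "min (2 powr (- 2 * of_int m)) (2 powr (- real j)) = (2::real) powr (min (- 2 * of_int m) (- real j))"
    by (cases "- 2 * real_of_int m \<le> - real j") (simp_all only: min_def powr_le_cancel_iff if_True if_False one_less_numeral_iff semiring_norm)
  have "2 powr (2 * of_int m * \<tau>) * (2 powr (real j * s) *
     (min (2 powr (- 2 * of_int m)) (2 powr (- real j))) powr (1 / p))
     = 2 powr (2 * of_int m * \<tau> + (real j * s + min (- 2 * of_int m) (- real j) * (1 / p)))"
    unfolding eq powr_powr powr_add by (rule refl)
  also have "\<dots> \<le> 2 powr 0"
  proof (intro powr_mono)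
    define q where "q = 1 / p"
    have q: "\<tau> + s \<le> q" using s by (simp add: q_def)
    define M :: real where "M = of_int m"
    show "2 * of_int m * \<tau> + (real j * s + min (- 2 * of_int m) (- real j) * (1 / p)) \<le> 0"
      unfolding q_def [symmetric] M_def [symmetric]
    proof (cases "real j \<le> 2 * M")
      case True
      then have "0 \<le> M" by simp
      have "real j * s \<le> 2 * M * s" using True s by (intro mult_right_mono) auto
      moreover have "2 * M * (\<tau> + s) \<le> 2 * M * q" using q \<open>0 \<le> M\<close> by (intro mult_left_mono) auto
      moreover have mn: "min (- 2 * M) (- real j) = - 2 * M" using True by (simp add: min_def)
      ultimately show "2 * M * \<tau> + (real j * s + min (- 2 * M) (- real j) * q) \<le> 0"
        unfolding mn distrib_left by linarith
    next
      case False
      have "2 * M * \<tau> \<le> real j * \<tau>" using False \<tau> by (intro mult_right_mono) auto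
      moreover have "real j * (\<tau> + s) \<le> real j * q" using q by (intro mult_left_mono) auto
      moreover have mn: "min (- 2 * M) (- real j) = - real j" using False by (simp add: min_def)
      ultimately show "2 * M * \<tau> + (real j * s + min (- 2 * M) (- real j) * q) \<le> 0"
        unfolding mn distrib_left by linarith
    qed
  qed simp
  finally show ?thesis by simp
qed

lemma besov_type_norm_spiral_finite:
  fixes \<phi>0 \<phi> :: "real^2 \<Rightarrow> complex"
  assumes adm: "admissible_pair \<phi>0 \<phi>" and p: "1 \<le> p" and \<tau>: "0 \<le> \<tau>" and s: "0 < s" "\<tau> + s \<le> 1 / p"
  shows "besov_type_norm \<phi>0 \<phi> s \<tau> (ennreal p) \<infinity> (regular_distribution (indicator spiral)) < \<infinity>"
proof -
  have sch: "\<phi>0 \<in> schwartz" "\<phi> \<in> schwartz" using adm by (auto simp: admissible_pair_def)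
  obtain K where K: "0 < K" and bound: "\<And>j m k. (\<integral>\<^sup>+x. ennreal (norm (spiral_conv (if j = 0 then \<phi>0 else \<phi>) ((1/2) ^ j) x) powr p) * indicator (dyadic_cube m k) x \<partial>lborel)
       \<le> ennreal (K * min (2 powr (- 2 * of_int m)) (2 powr (- real j)))"
    using spiral_conv_Lp_bound[OF adm p] by blast
  have "besov_type_norm \<phi>0 \<phi> s \<tau> (ennreal p) \<infinity> (regular_distribution (indicator spiral)) \<le> ennreal (K powr (1 / p))"
    unfolding besov_type_norm_infinity
  proof (intro SUP_least)
    fix m :: int and k :: "int^2" and j :: nat assume j: "j \<in> {nat m..}"
    define \<mu> where "\<mu> = min (2 powr (- 2 * of_int m)) (2 powr (- real j))"
    have \<mu>: "0 \<le> \<mu>" by (simp add: \<mu>_def)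
    have "Lp_quasinorm (ennreal p) (dyadic_cube m k) (conv_distribution (dilated_family \<phi>0 \<phi> j) (regular_distribution (indicator spiral)))
        \<le> ennpowr (ennreal (K * \<mu>)) (1 / p)"
      unfolding Lp_quasinorm_ennreal[OF p] conv_distribution_spiral[OF sch] \<mu>_def
      using p by (intro ennpowr_mono bound) auto
    also have "\<dots> = ennreal (K powr (1 / p) * \<mu> powr (1 / p))"
      using K \<mu> by (simp add: ennpowr_ennreal powr_mult)
    finally have "ennreal (1 / measure lebesgue (dyadic_cube m k) powr \<tau>) *
        (ennreal (2 powr (real j * s)) * Lp_quasinorm (ennreal p) (dyadic_cube m k) (conv_distribution (dilated_family \<phi>0 \<phi> j) (regular_distribution (indicator spiral))))
       \<le> ennreal (2 powr (2 * of_int m * \<tau>)) * (ennreal (2 powr (real j * s)) * ennreal (K powr (1 / p) * \<mu> powr (1 / p)))"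
      unfolding dyadic_cube_weight by (intro mult_mono) auto
    also have "\<dots> = ennreal (K powr (1 / p) * (2 powr (2 * of_int m * \<tau>) * (2 powr (real j * s) * \<mu> powr (1 / p))))"
      by (simp add: mult_ac flip: ennreal_mult)
    also have "\<dots> \<le> ennreal (K powr (1 / p) * 1)"
      using besov_exponent_bound[OF p \<tau> s, of m j] j unfolding \<mu>_def
      by (intro ennreal_leI mult_left_mono) auto
    finally show "ennreal (1 / measure lebesgue (dyadic_cube m k) powr \<tau>) *
        (ennreal (2 powr (real j * s)) * Lp_quasinorm (ennreal p) (dyadic_cube m k) (conv_distribution (dilated_family \<phi>0 \<phi> j) (regular_distribution (indicator spiral))))
       \<le> ennreal (K powr (1 / p))" by simp
  qed
  then show ?thesis by (rule le_less_trans) simp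
qed

text \<open>The norm dominates the contributions of the cubes with a corner at the origin and edge length \<open>2\<^sup>-\<^sup>m\<close> at the scale
\<open>j = 2 m\<close>, and these grow exponentially in \<open>m\<close>, up to a power of \<open>m\<close>.\<close>

lemma besov_type_norm_spiral_infinite:
  fixes \<phi>0 \<phi> :: "real^2 \<Rightarrow> complex"
  assumes adm: "admissible_pair \<phi>0 \<phi>" and p: "1 \<le> p" and gt: "1 / p < \<tau> + s"
  shows "besov_type_norm \<phi>0 \<phi> s \<tau> (ennreal p) \<infinity> (regular_distribution (indicator spiral)) = \<infinity>"
proof -
  let ?N = "besov_type_norm \<phi>0 \<phi> s \<tau> (ennreal p) \<infinity> (regular_distribution (indicator spiral))"
  have sch: "\<phi>0 \<in> schwartz" "\<phi> \<in> schwartz" using adm by (auto simp: admissible_pair_def)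
  note i = schwartz_integrable(1)[OF sch(2)]
  obtain a where a: "(\<integral>w. \<phi> w * indicator {w. a < w $ 1} w \<partial>lborel) \<noteq> 0"
    using exists_nonzero_halfspace_integral[OF i admissible_pair_frequency[OF adm]] by blast
  obtain c K where c: "0 < c" "0 < K" and ev: "\<forall>\<^sub>F m in sequentially. \<exists>A \<in> sets borel. A \<subseteq> dyadic_cube (int m) 0 \<and>
       (\<forall>x\<in>A. c \<le> norm (spiral_conv \<phi> ((1/2) ^ (2 * m)) x)) \<and>
       ennreal (K * (1/2) ^ (2 * m) / (real m + 2) ^ 4) \<le> emeasure lborel A"
    using spiral_conv_large_set[OF i a] by blast
  define \<beta> where "\<beta> = \<tau> + s - 1 / p"
  have \<beta>: "0 < \<beta>" using gt by (simp add: \<beta>_def)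
  define G where "G m = c * K powr (1 / p) * (2 powr (2 * real m * \<beta>) * (real m + 2) powr (- 4 / p))" for m :: nat
  have lower: "\<forall>\<^sub>F m in sequentially. ennreal (G m) \<le> ?N"
    using ev eventually_gt_at_top[of 0]
  proof eventually_elim
    fix m :: nat assume "\<exists>A \<in> sets borel. A \<subseteq> dyadic_cube (int m) 0 \<and>
       (\<forall>x\<in>A. c \<le> norm (spiral_conv \<phi> ((1/2) ^ (2 * m)) x)) \<and>
       ennreal (K * (1/2) ^ (2 * m) / (real m + 2) ^ 4) \<le> emeasure lborel A" and m: "0 < m"
    then obtain A where A [measurable]: "A \<in> sets borel" and sub: "A \<subseteq> dyadic_cube (int m) 0"
      and large: "\<And>x. x \<in> A \<Longrightarrow> c \<le> norm (spiral_conv \<phi> ((1/2) ^ (2 * m)) x)"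
      and size: "ennreal (K * (1/2) ^ (2 * m) / (real m + 2) ^ 4) \<le> emeasure lborel A" by blast
    define v where "v = K * (1/2) ^ (2 * m) / (real m + 2) ^ 4"
    have v: "0 \<le> v" using c by (simp add: v_def)
    have "ennreal (c powr p * v) = ennreal (c powr p) * ennreal v" using v by (simp add: ennreal_mult)
    also have "\<dots> \<le> ennreal (c powr p) * emeasure lborel A" using size unfolding v_def by (rule mult_left_mono) simp
    also have "\<dots> = (\<integral>\<^sup>+x. ennreal (c powr p) * indicator A x \<partial>lborel)" by (subst nn_integral_cmult_indicator) auto
    also have "\<dots> \<le> (\<integral>\<^sup>+x. ennreal (norm (spiral_conv \<phi> ((1/2) ^ (2 * m)) x) powr p) * indicator (dyadic_cube (int m) 0) x \<partial>lborel)"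
      using large sub c p by (intro nn_integral_mono) (auto simp: indicator_def intro!: ennreal_leI powr_mono2)
    finally have "ennpowr (ennreal (c powr p * v)) (1 / p)
      \<le> Lp_quasinorm (ennreal p) (dyadic_cube (int m) 0) (conv_distribution (dilated_family \<phi>0 \<phi> (2 * m)) (regular_distribution (indicator spiral)))"
      unfolding Lp_quasinorm_ennreal[OF p] conv_distribution_spiral[OF sch]
      using p m by (intro ennpowr_mono) auto
    moreover have "ennpowr (ennreal (c powr p * v)) (1 / p) = ennreal (c * v powr (1 / p))"
      using c v p by (simp add: ennpowr_ennreal powr_mult powr_powr)
    ultimately have Lp: "ennreal (c * v powr (1 / p))
      \<le> Lp_quasinorm (ennreal p) (dyadic_cube (int m) 0) (conv_distribution (dilated_family \<phi>0 \<phi> (2 * m)) (regular_distribution (indicator spiral)))"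
      by simp
    have "v = K * (2 powr (- 2 * real m) * (real m + 2) powr (- 4))"
    proof -
      have "(2::real) powr (- 2 * real m) = inverse (2 powr (real (2 * m)))"
        unfolding powr_minus [symmetric] by simp
      also have "(2::real) powr (real (2 * m)) = 2 ^ (2 * m)" by (rule powr_realpow) simp
      finally have 1: "(1/2::real) ^ (2 * m) = 2 powr (- 2 * real m)"
        by (simp add: power_one_over inverse_eq_divide)
      have 2: "(real m + 2) powr (- 4) = inverse ((real m + 2) ^ 4)"
        unfolding powr_minus by simp
      show ?thesis unfolding v_def 1 2 by (simp add: divide_inverse)
    qed
    then have vp: "v powr (1 / p) = K powr (1 / p) * (2 powr (- 2 * real m * (1 / p)) * (real m + 2) powr (- 4 / p))"
      using c by (simp add: powr_mult powr_powr)
    have e: "2 powr (2 * real m * \<beta>) = 2 powr (2 * real m * \<tau>) * (2 powr (real (2 * m) * s) * 2 powr (- 2 * real m * (1 / p)))"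
      unfolding powr_add [symmetric] by (simp add: \<beta>_def algebra_simps)
    have "ennreal (G m) = ennreal (2 powr (2 * real m * \<tau>)) * (ennreal (2 powr (real (2 * m) * s)) * ennreal (c * v powr (1 / p)))"
      unfolding G_def e vp using c by (simp add: mult_ac flip: ennreal_mult)
    also have "\<dots> \<le> ennreal (1 / measure lebesgue (dyadic_cube (int m) (0::int^2)) powr \<tau>) * (ennreal (2 powr (real (2 * m) * s)) *
       Lp_quasinorm (ennreal p) (dyadic_cube (int m) 0) (conv_distribution (dilated_family \<phi>0 \<phi> (2 * m)) (regular_distribution (indicator spiral))))"
      unfolding dyadic_cube_weight using Lp by (intro mult_mono) auto
    also have "\<dots> \<le> ?N"
      unfolding besov_type_norm_infinity
      by (rule SUP_upper2[of "int m"], simp, rule SUP_upper2[of 0], simp, rule SUP_upper) auto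
    finally show "ennreal (G m) \<le> ?N" .
  qed
  have "filterlim G at_top sequentially"
  proof -
    have "filterlim (\<lambda>m::nat. 2 powr (2 * real m * \<beta>) * (real m + 2) powr (- 4 / p)) at_top sequentially"
      using \<beta> p by real_asymp
    then show ?thesis unfolding G_def using c by (intro filterlim_tendsto_pos_mult_at_top[OF tendsto_const]) auto
  qed
  have unbounded: "ennreal B \<le> ?N" for B
  proof -
    have "\<forall>\<^sub>F m in sequentially. B \<le> G m" using \<open>filterlim G at_top sequentially\<close> by (simp add: filterlim_at_top)
    then have "\<forall>\<^sub>F m in sequentially. ennreal B \<le> ?N" using lower
      by eventually_elim (meson ennreal_leI order_trans)
    then show ?thesis unfolding eventually_sequentially by blast
  qed
  show ?thesis
  proof (cases ?N)
    case (real r)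
    with unbounded[of "r + 1"] show ?thesis by (simp add: ennreal_le_iff)
  qed simp
qed

theorem theorem4p24:
  fixes \<phi>0 \<phi> :: "real^2 \<Rightarrow> complex" and p \<tau> s :: real
  assumes "admissible_pair \<phi>0 \<phi>"
    and "1 \<le> p"
    and "0 \<le> \<tau>" and "\<tau> \<le> 1 / p"
    and "0 < s" and "s \<le> 1 / p"
  shows "regular_distribution (indicator spiral) \<in> besov_type_space \<phi>0 \<phi> s \<tau> (ennreal p) \<infinity>
    \<longleftrightarrow> \<tau> + s \<le> 1 / p"
proof
  assume "regular_distribution (indicator spiral) \<in> besov_type_space \<phi>0 \<phi> s \<tau> (ennreal p) \<infinity>"
  then have "besov_type_norm \<phi>0 \<phi> s \<tau> (ennreal p) \<infinity> (regular_distribution (indicator spiral)) < \<infinity>"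
    by (simp add: besov_type_space_def)
  then show "\<tau> + s \<le> 1 / p"
    using besov_type_norm_spiral_infinite[OF assms(1,2), of \<tau> s] by (cases "\<tau> + s \<le> 1 / p") auto
next
  assume "\<tau> + s \<le> 1 / p"
  then show "regular_distribution (indicator spiral) \<in> besov_type_space \<phi>0 \<phi> s \<tau> (ennreal p) \<infinity>"
    using besov_type_norm_spiral_finite[OF assms(1,2,3,5)] regular_distribution_spiral_tempered
    by (simp add: besov_type_space_def)
qed

end
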